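(* Consider the encoder, described in the context, of the coding scheme with $M$ super-channel uses, each comprising $L$ uses of a binary-input discrete memoryless channel ($L,M$ powers of two), with overall blocklength $N=ML$. The encoder has complexity $O(N\log N)$.
   Context: Complexity counts elementary operations (unit-cost bit operations, arithmetic operations on real numbers, and drawing a Bernoulli random variable with given parameter); all index sets below are assumed precomputed. For $n=2^k$, $G_n=\begin{pmatrix}1&0\\1&1\end{pmatrix}^{\otimes k}$ over $\mathbb{F}_2$, acting on row vectors from the right; $u^i=[u_1,\dots,u_i]$. Let $p\in[0,1]$ be such that $\mathrm{Bernoulli}(p)$ is a capacity-achieving input distribution of the channel, $X^L$ i.i.d. $\mathrm{Bernoulli}(p)$, $U^L=X^LG_L$, $\mathcal{R}_\epsilon=\{i\in\{1,\dots,L\}:H(U_i|U^{i-1})\ge1-\epsilon\}$ and $K=|\mathcal{R}_\epsilon|$. Outer encoder: for each $i=1,\dots,K$, a vector $t^{(i)}\in\mathbb{F}_2^M$, consisting of frozen bits (given) in a given subset of positions and message bits in the other positions, is mapped to $v_i^M=t^{(i)}G_M$. Inner encoder: for each $m=1,\dots,M$, the vector $u^K$ formed from the $m$th entries of $v_1^M,\dots,v_K^M$ is passed through the shaper, which generates $\hat U_1,\dots,\hat U_L$ successively: if $i$ is the $r$th element of $\mathcal{R}_\epsilon$ (ordered increasingly), $\hat U_i=u_r$; if $i\notin\mathcal{R}_\epsilon$, $\hat U_i$ is drawn from the conditional distribution of $U_i$ given $U^{i-1}=\hat U^{i-1}$; the shaper outputs $\hat X^L=\hat U^LG_L$. The $M$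 blocks $\hat X^L$ (a total of $N$ bits) are the output of the encoder. *)

theory Defs
  imports
    "HOL-Probability.Probability"
    "HOL-Library.Z2"
    "HOL-Library.Landau_Symbols"
    "Jordan_Normal_Form.Matrix"
begin

text \<open>
  Vectors over $F_2$ are lists of bits. All indices start at 0, so the prefix
  $u^i = [u_1,\dots,u_i]$ is \<open>take i u\<close> and $u_{i+1}$ is \<open>u ! i\<close>. Lengths that are powers of
  two are given by their exponents: $L = 2^a$ and $M = 2^b$.
\<close>

section \<open>The polar transform\<close>

definition kronecker :: "'a::times mat \<Rightarrow> 'a mat \<Rightarrow> 'a mat" where
  "kronecker A B =
     Matrix.mat (dim_row A * dim_row B) (dim_col A * dim_col B)
       (\<lambda>(i, j). A $$ (i div dim_row B, j div dim_col B) * B $$ (i mod dim_row B, j mod dim_col B))"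

primrec polar_matrix :: "nat \<Rightarrow> bit mat" where
  "polar_matrix 0 = 1\<^sub>m 1"
| "polar_matrix (Suc k) = kronecker (mat_of_rows_list 2 [[1, 0], [1, 1]]) (polar_matrix k)"

text \<open>The transpose turns the library's action on column vectors into the one on row vectors.\<close>

definition polar_transform :: "nat \<Rightarrow> bit list \<Rightarrow> bit list" where
  "polar_transform k u = list_of_vec (transpose_mat (polar_matrix k) *\<^sub>v vec_of_list u)"


section \<open>Channel and input distribution\<close>

definition bernoulli_bit :: "real \<Rightarrow> bit pmf" where
  "bernoulli_bit p = map_pmf of_bool (bernoulli_pmf p)"

definition channel_joint :: "(bit \<Rightarrow> 'y pmf) \<Rightarrow> real \<Rightarrow> (bit \<times> 'y) pmf" where
  "channel_joint W p = bind_pmf (bernoulli_bit p) (\<lambda>x. map_pmf (Pair x) (W x))"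

definition channel_information :: "(bit \<Rightarrow> 'y pmf) \<Rightarrow> real \<Rightarrow> real" where
  "channel_information W p =
     prob_space.mutual_information (measure_pmf (channel_joint W p)) 2
       (count_space UNIV) (count_space UNIV) fst snd"

definition capacity :: "(bit \<Rightarrow> 'y pmf) \<Rightarrow> real" where
  "capacity W = (SUP p\<in>{0..1}. channel_information W p)"

definition capacity_achieving :: "(bit \<Rightarrow> 'y pmf) \<Rightarrow> real \<Rightarrow> bool" where
  "capacity_achieving W p \<longleftrightarrow> p \<in> {0..1} \<and> channel_information W p = capacity W"

text \<open>The law of $U^L = X^L G_L$ for $X^L$ i.i.d. Bernoulli(p).\<close>

definition U_pmf :: "real \<Rightarrow> nat \<Rightarrow> bit list pmf" where
  "U_pmf p a = map_pmf (polar_transform a) (replicate_pmf (2 ^ a) (bernoulli_bit p))"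

definition U_entropy :: "real \<Rightarrow> nat \<Rightarrow> nat \<Rightarrow> real" where
  "U_entropy p a i =
     prob_space.conditional_entropy (measure_pmf (U_pmf p a)) 2
       (count_space UNIV) (count_space UNIV) (\<lambda>u. u ! i) (take i)"

definition R_set :: "real \<Rightarrow> nat \<Rightarrow> real \<Rightarrow> nat set" where
  "R_set p a \<epsilon> = {i. i < 2 ^ a \<and> U_entropy p a i \<ge> 1 - \<epsilon>}"


section \<open>The encoder\<close>

text \<open>
  The bits \<open>f\<close> fill the positions in \<open>F\<close> in increasing order, the bits \<open>d\<close> the
  remaining positions.
\<close>

definition outer_input :: "nat \<Rightarrow> nat set \<Rightarrow> bit list \<Rightarrow> bit list \<Rightarrow> bit list" where
  "outer_input n F f d =
     map (\<lambda>j. if j \<in> F then f ! card (F \<inter> {..<j}) else d ! card ({..<j} - F)) [0..<n]"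

text \<open>
  \<open>U_next p a w\<close> is the conditional law of $U_{i+1}$ given $U^i = w$, where \<open>i = length w\<close>.
\<close>

definition U_next :: "real \<Rightarrow> nat \<Rightarrow> bit list \<Rightarrow> bit pmf" where
  "U_next p a w =
     map_pmf (\<lambda>u. u ! length w) (cond_pmf (U_pmf p a) {u. take (length w) u = w})"

primrec shaper_prefix :: "real \<Rightarrow> nat \<Rightarrow> nat set \<Rightarrow> bit list \<Rightarrow> nat \<Rightarrow> bit list pmf" where
  "shaper_prefix p a R u 0 = return_pmf []"
| "shaper_prefix p a R u (Suc i) =
     bind_pmf (shaper_prefix p a R u i) (\<lambda>w.
       map_pmf (\<lambda>c. w @ [c])
         (if i \<in> R then return_pmf (u ! card (R \<inter> {..<i})) else U_next p a w))"

definition shaper :: "real \<Rightarrow> nat \<Rightarrow> nat set \<Rightarrow> bit list \<Rightarrow> bit list pmf" where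
  "shaper p a R u = map_pmf (polar_transform a) (shaper_prefix p a R u (2 ^ a))"

text \<open>
  \<open>Fs ! i\<close>, \<open>fs ! i\<close> and \<open>ds ! i\<close> are the frozen positions, the frozen bits and the message bits
  of the \<open>i\<close>th outer code. The shapers of different blocks use independent randomness.
\<close>

definition valid_input ::
    "nat \<Rightarrow> nat \<Rightarrow> nat set list \<Rightarrow> bit list list \<Rightarrow> bit list list \<Rightarrow> bool" where
  "valid_input K n Fs fs ds \<longleftrightarrow>
     length Fs = K \<and> length fs = K \<and> length ds = K \<and>
     (\<forall>i<K. Fs ! i \<subseteq> {..<n} \<and> length (fs ! i) = card (Fs ! i) \<and>
            length (ds ! i) = n - card (Fs ! i))"

definition outer_encoder ::
    "nat \<Rightarrow> nat set list \<Rightarrow> bit list list \<Rightarrow> bit list list \<Rightarrow> bit list list" where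
  "outer_encoder b Fs fs ds =
     map (\<lambda>i. polar_transform b (outer_input (2 ^ b) (Fs ! i) (fs ! i) (ds ! i))) [0..<length Fs]"

definition inner_encoder :: "real \<Rightarrow> nat \<Rightarrow> nat \<Rightarrow> nat set \<Rightarrow> bit list list \<Rightarrow> bit list pmf" where
  "inner_encoder p a b R vs =
     map_pmf (\<lambda>x. concat (map x [0..<2 ^ b]))
       (Pi_pmf {..<2 ^ b} [] (\<lambda>m. shaper p a R (map (\<lambda>v. v ! m) vs)))"

definition encoder ::
    "real \<Rightarrow> real \<Rightarrow> nat \<Rightarrow> nat \<Rightarrow> nat set list \<Rightarrow> bit list list \<Rightarrow> bit list list \<Rightarrow> bit list pmf" where
  "encoder p \<epsilon> a b Fs fs ds = inner_encoder p a b (R_set p a \<epsilon>) (outer_encoder b Fs fs ds)"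


section \<open>The computational model\<close>

text \<open>
  Randomized straight-line programs over a memory of bits and a memory of real numbers, both
  addressed by natural numbers; in each instruction the first address is the target. Every
  instruction is one elementary operation, so the cost of a program is its length. A program can
  neither branch on data nor contain real constants. Real division by zero yields 0, and
  \<open>Draw\<close> clamps its parameter to the unit interval; both are the library's conventions.
\<close>

datatype instr =
    Bit_Const nat bit
  | Bit_Add nat nat nat
  | Bit_Mul nat nat nat
  | Real_Of_Bit nat nat
  | Real_Add nat nat nat
  | Real_Sub nat nat nat
  | Real_Mul nat nat nat
  | Real_Div nat nat nat
  | Draw nat nat

type_synonym memory = "(nat \<Rightarrow> bit) \<times> (nat \<Rightarrow> real)"

fun exec :: "instr \<Rightarrow> memory \<Rightarrow> memory pmf" where
  "exec (Bit_Const i c) (B, X) = return_pmf (B(i := c), X)"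
| "exec (Bit_Add i j k) (B, X) = return_pmf (B(i := B j + B k), X)"
| "exec (Bit_Mul i j k) (B, X) = return_pmf (B(i := B j * B k), X)"
| "exec (Real_Of_Bit i j) (B, X) = return_pmf (B, X(i := of_bool (B j = 1)))"
| "exec (Real_Add i j k) (B, X) = return_pmf (B, X(i := X j + X k))"
| "exec (Real_Sub i j k) (B, X) = return_pmf (B, X(i := X j - X k))"
| "exec (Real_Mul i j k) (B, X) = return_pmf (B, X(i := X j * X k))"
| "exec (Real_Div i j k) (B, X) = return_pmf (B, X(i := X j / X k))"
| "exec (Draw i j) (B, X) = map_pmf (\<lambda>c. (B(i := c), X)) (bernoulli_bit (X j))"

primrec run :: "instr list \<Rightarrow> memory \<Rightarrow> memory pmf" where
  "run [] s = return_pmf s"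
| "run (c # cs) s = bind_pmf (exec c s) (run cs)"

definition initial_memory :: "real \<Rightarrow> bit list \<Rightarrow> memory" where
  "initial_memory p xs = ((\<lambda>i. if i < length xs then xs ! i else 0), (\<lambda>i. if i = 0 then p else 0))"

definition program_output :: "instr list \<Rightarrow> nat \<Rightarrow> real \<Rightarrow> bit list \<Rightarrow> bit list pmf" where
  "program_output P n p xs = map_pmf (\<lambda>(B, X). map B [0..<n]) (run P (initial_memory p xs))"

end

theory Submission
  imports Defs
begin

text \<open>
  The shaper is successive cancellation sampling. Let $X^{2n}$ have independent components with
  weights $w_j$, and let $(s, t)$ be the polar transforms of the two halves of $U^{2n}$, so that
  $X = (s + t, t)$. Then $s$ again has independent components, with the weights $w^-$, and given
  $s$ so has $t$, with the weights $w^+$. Hence one can recursively generate $s$, which takes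
  care of the first half of $U$, then $t$, and combine; this produces $X$ and $U$ together in
  $O(n)$ operations per level of the recursion. Summed over the $M$ blocks this costs
  $O(N \log L)$, and the $K \le L$ outer transforms cost $O(N \log M)$.

  The weights are never normalized: a quotient is only formed when a bit is drawn, and the
  numerator and denominator there are exactly the probabilities of prefixes of $U$.
\<close>

text \<open>The specification draws U bit by bit from conditional laws on words of length L, whereas
  the recursion returns X in halves. They meet in \<open>mass\<close>, the total weight of the words
  with a given prefix, taken for arbitrary product weights because w^+ varies with the position and
  is not normalized. Three obstacles shape the rest. A conditional law given a null event is
  unspecified, so the prefixes at which a bit is drawn must be shown to have positive probability;
  only here does it matter that \<open>R_set\<close> is defined by entropies. Programs cannot branch
  on data, so the dependence of w^+ on s is computed arithmetically, while whatever depends on the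
  index sets alone is settled when the program is built. A run leaves random remnants in memory, so
  programs with draws are compared with laws by couplings.\<close>

section \<open>The polar transform\<close>

text \<open>These rules of \<^theory>\<open>HOL-Library.Z2\<close> rewrite field arithmetic on bits to bit operations.\<close>

declare add_bit_eq_xor [simp del] mult_bit_eq_and [simp del]

lemma bit_double [simp]: "x + x = 0" for x :: bit
  by (cases x) simp_all

lemma UNIV_bit: "(UNIV :: bit set) = {0, 1}"
  using bit_not_one_iff by blast

lemma finite_words: "finite {u :: bit list. length u = n \<and> P u}"
proof -
  have "finite {u :: bit list. set u \<subseteq> UNIV \<and> length u = n}"
    by (rule finite_lists_length_eq) (simp add: UNIV_bit)
  then show ?thesis by (rule rev_finite_subset) auto
qed

lemma dim_polar_matrix [simp]:
  "dim_row (polar_matrix k) = 2 ^ k" "dim_col (polar_matrix k) = 2 ^ k"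
  by (induction k) (simp_all add: kronecker_def mat_of_rows_list_def)

lemma length_polar_transform [simp]: "length (polar_transform k u) = 2 ^ k"
  by (simp add: polar_transform_def)

lemma polar_transform_nth:
  assumes "length u = 2 ^ k" "j < 2 ^ k"
  shows "polar_transform k u ! j = (\<Sum>i<2 ^ k. polar_matrix k $$ (i, j) * u ! i)"
  using assms
  by (simp add: polar_transform_def list_of_vec_index scalar_prod_def vec_of_list_index
      lessThan_atLeast0)

lemma polar_transform_0 [simp]: "length u = 1 \<Longrightarrow> polar_transform 0 u = u"
  by (rule nth_equalityI) (simp_all add: polar_transform_nth)

lemma sum_lessThan_add:
  "(\<Sum>i<m + n. f i) = (\<Sum>i<m. f i) + (\<Sum>i<n. f (m + i))"
  for m n :: nat and f :: "nat \<Rightarrow> 'b::comm_monoid_add"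
  by (induction n) (simp_all add: algebra_simps)

lemma prod_lessThan_add:
  "(\<Prod>i<m + n. f i) = (\<Prod>i<m. f i) * (\<Prod>i<n. f (m + i))"
  for m n :: nat and f :: "nat \<Rightarrow> 'b::comm_monoid_mult"
  by (induction n) (simp_all add: algebra_simps)

text \<open>In block form \<open>polar_matrix (Suc k)\<close> has the rows (G, 0) and (G, G), so the
  row vector (u, v) is sent to (u G + v G, v G). The sampler and the programs follow this
  recursion.\<close>

lemma polar_transform_append:
  assumes u: "length u = 2 ^ k" and v: "length v = 2 ^ k"
  shows "polar_transform (Suc k) (u @ v) =
    map2 (+) (polar_transform k u) (polar_transform k v) @ polar_transform k v"
proof (rule nth_equalityI)
  fix j assume "j < length (polar_transform (Suc k) (u @ v))"
  then have j: "j < 2 * 2 ^ k" by simp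
  have K: "polar_matrix (Suc k) $$ (i, j) =
      mat_of_rows_list 2 [[1, 0], [1, 1]] $$ (i div 2 ^ k, j div 2 ^ k) * polar_matrix k $$ (i mod 2 ^ k, j mod 2 ^ k)"
    if "i < 2 * 2 ^ k" for i
    using that j by (simp add: kronecker_def mat_of_rows_list_def)
  have *: "polar_transform (Suc k) (u @ v) ! j =
     (\<Sum>i<2 ^ k. polar_matrix (Suc k) $$ (i, j) * u ! i) + (\<Sum>i<2 ^ k. polar_matrix (Suc k) $$ (2 ^ k + i, j) * v ! i)"
    using j u v by (simp add: polar_transform_nth mult_2 sum_lessThan_add nth_append del: polar_matrix.simps)
  show "polar_transform (Suc k) (u @ v) ! j =
    (map2 (+) (polar_transform k u) (polar_transform k v) @ polar_transform k v) ! j"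
  proof (cases "j < 2 ^ k")
    case True
    then show ?thesis unfolding * using u v
      by (simp add: nth_append K polar_transform_nth del: polar_matrix.simps)
         (simp add: mat_of_rows_list_def)
  next
    case False
    then have "j div 2 ^ k = 1" "j mod 2 ^ k = j - 2 ^ k" using j
      by (auto simp: div_nat_eqI mod_if)
    then show ?thesis unfolding * using u v False j
      by (simp add: nth_append K polar_transform_nth del: polar_matrix.simps)
         (simp add: mat_of_rows_list_def)
  qed
qed simp_all

lemma map2_add_cancel:
  "length s = length t \<Longrightarrow> map2 (+) (map2 (+) s t) t = s" for s t :: "bit list"
  by (rule nth_equalityI) (simp_all add: add.assoc)

lemma polar_transform_involution:
  "length u = 2 ^ k \<Longrightarrow> polar_transform k (polar_transform k u) = u"
proof (induction k arbitrary: u)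
  case (Suc k)
  define s t where "s = take (2 ^ k) u" and "t = drop (2 ^ k) u"
  have st: "u = s @ t" "length s = 2 ^ k" "length t = 2 ^ k"
    using Suc.prems by (auto simp: s_def t_def)
  \<comment> \<open>Linearity moves the sum inside the half-length transform, where the induction
    hypothesis applies; what is left is (s + t) + t = s in characteristic 2.\<close>
  have lin: "map2 (+) (polar_transform k x) (polar_transform k y) = polar_transform k (map2 (+) x y)"
    if "length x = 2 ^ k" "length y = 2 ^ k" for x y
  proof (rule nth_equalityI)
    fix j assume "j < length (map2 (+) (polar_transform k x) (polar_transform k y))"
    then have j: "j < 2 ^ k" by simp
    have "map2 (+) (polar_transform k x) (polar_transform k y) ! j =
        polar_transform k x ! j + polar_transform k y ! j" using j by simp
    also have "\<dots> = (\<Sum>i<2 ^ k. polar_matrix k $$ (i, j) * (x ! i + y ! i))"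
      using that j by (simp only: polar_transform_nth sum.distrib ring_distribs)
    also have "\<dots> = (\<Sum>i<2 ^ k. polar_matrix k $$ (i, j) * (map2 (+) x y ! i))"
      using that by (intro sum.cong arg_cong2[where f = "(*)"]) simp_all
    also have "\<dots> = polar_transform k (map2 (+) x y) ! j"
      using that j by (subst polar_transform_nth) simp_all
    finally show "map2 (+) (polar_transform k x) (polar_transform k y) ! j = polar_transform k (map2 (+) x y) ! j" .
  qed simp
  show ?case unfolding st(1) using st
    by (simp add: polar_transform_append lin Suc.IH map2_add_cancel)
qed simp

lemma words_Suc: "{u :: bit list. length u = Suc n} = (\<lambda>(u, x). u @ [x]) ` ({u. length u = n} \<times> UNIV)"
  by (auto simp: length_Suc_conv_rev image_iff)

text \<open>Distributivity. It is what collapses the sum over the exponentially many values of the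
  free half of U into one sum per position.\<close>

lemma sum_words_prod:
  fixes g :: "nat \<Rightarrow> bit \<Rightarrow> real"
  shows "(\<Sum>u | length u = n. \<Prod>j<n. g j (u ! j)) = (\<Prod>j<n. g j 0 + g j 1)"
proof (induction n)
  case (Suc n)
  have "(\<Sum>u | length u = Suc n. \<Prod>j<Suc n. g j (u ! j)) =
      (\<Sum>(u, x)\<in>{u. length u = n} \<times> UNIV. \<Prod>j<Suc n. g j ((u @ [x]) ! j))"
    unfolding words_Suc
    by (subst sum.reindex) (auto simp: inj_on_def case_prod_unfold)
  also have "\<dots> = (\<Sum>(u, x)\<in>{u. length u = n} \<times> UNIV. (\<Prod>j<n. g j (u ! j)) * g n x)"
    by (intro sum.cong) (auto simp: nth_append)
  also have "\<dots> = (\<Sum>u | length u = n. \<Prod>j<n. g j (u ! j)) * (\<Sum>x\<in>UNIV. g n x)"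
    by (simp add: sum_product sum.cartesian_product)
  finally show ?case by (simp add: Suc.IH UNIV_bit)
qed simp

lemma bij_betw_polar_transform:
  "bij_betw (polar_transform k) {u. length u = 2 ^ k} {u. length u = 2 ^ k}"
  by (rule bij_betw_byWitness[where f' = "polar_transform k"]) (auto simp: polar_transform_involution)

section \<open>Successive cancellation sampling\<close>

text \<open>For Bernoulli weights this is the probability that U begins with \<open>v\<close>; the
  sum runs over U, the weights apply to X.\<close>

definition mass :: "nat \<Rightarrow> (nat \<Rightarrow> bit \<Rightarrow> real) \<Rightarrow> bit list \<Rightarrow> real" where
  "mass k w v =
     (\<Sum>u | length u = 2 ^ k \<and> take (length v) u = v. \<Prod>j<2 ^ k. w j (polar_transform k u ! j))"

text \<open>
  The names follow Arikan's channels $W^-$ and $W^+$: the unnormalized laws of component \<open>j\<close> of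
  \<open>s\<close>, and of component \<open>j\<close> of \<open>t\<close> given \<open>s\<close>.
\<close>

definition minus_weights :: "nat \<Rightarrow> (nat \<Rightarrow> bit \<Rightarrow> real) \<Rightarrow> nat \<Rightarrow> bit \<Rightarrow> real" where
  "minus_weights n w j z = w j z * w (n + j) 0 + w j (z + 1) * w (n + j) 1"

definition plus_weights :: "nat \<Rightarrow> (nat \<Rightarrow> bit \<Rightarrow> real) \<Rightarrow> bit list \<Rightarrow> nat \<Rightarrow> bit \<Rightarrow> real" where
  "plus_weights n w s j z = w j (s ! j + z) * w (n + j) z"

text \<open>Positions j and n + j of X carry s_j + t_j and t_j, so pairing these two factors gives
  one factor per bit of t.\<close>

lemma prod_polar_transform_append:
  assumes "length u = 2 ^ k" "length v = 2 ^ k"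
  shows "(\<Prod>j<2 ^ Suc k. w j (polar_transform (Suc k) (u @ v) ! j)) =
    (\<Prod>j<2 ^ k. plus_weights (2 ^ k) w (polar_transform k u) j (polar_transform k v ! j))"
  using assms
  by (simp add: mult_2 prod_lessThan_add nth_append polar_transform_append plus_weights_def prod.distrib)

text \<open>The prefix does not constrain the second half, so t runs over all words independently of
  s, and summing \<open>plus_weights\<close> over t_j leaves \<open>minus_weights\<close> at
  s_j.\<close>

lemma mass_Suc_left:
  assumes "length v \<le> 2 ^ k"
  shows "mass (Suc k) w v = mass k (minus_weights (2 ^ k) w) v"
proof -
  let ?A = "{u. length u = 2 ^ k \<and> take (length v) u = v}"
  let ?B = "{u :: bit list. length u = 2 ^ k}"
  have *: "{u. length u = 2 ^ Suc k \<and> take (length v) u = v} = (\<lambda>(x, y). x @ y) ` (?A \<times> ?B)"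
  proof (intro equalityI subsetI)
    fix u assume "u \<in> {u. length u = 2 ^ Suc k \<and> take (length v) u = v}"
    then have "take (2 ^ k) u \<in> ?A" "drop (2 ^ k) u \<in> ?B"
      using assms by (auto simp: min_def)
    then show "u \<in> (\<lambda>(x, y). x @ y) ` (?A \<times> ?B)"
      by (intro image_eqI[where x = "(take (2 ^ k) u, drop (2 ^ k) u)"] SigmaI) simp_all
  qed (use assms in auto)
  have "mass (Suc k) w v = (\<Sum>(x, y)\<in>?A \<times> ?B. \<Prod>j<2 ^ Suc k. w j (polar_transform (Suc k) (x @ y) ! j))"
    unfolding mass_def * by (subst sum.reindex) (auto simp: inj_on_def case_prod_unfold)
  also have "\<dots> = (\<Sum>x\<in>?A. \<Sum>y\<in>?B.
      \<Prod>j<2 ^ k. plus_weights (2 ^ k) w (polar_transform k x) j (polar_transform k y ! j))"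
    unfolding sum.cartesian_product
    by (intro sum.cong refl) (clarsimp simp: prod_polar_transform_append simp del: power_Suc)
  \<comment> \<open>The transform permutes the words of length 2^k, so the free half may be summed
    over t directly.\<close>
  also have "\<dots> = (\<Sum>x\<in>?A. \<Sum>y\<in>?B.
      \<Prod>j<2 ^ k. plus_weights (2 ^ k) w (polar_transform k x) j (y ! j))"
    by (rule sum.cong[OF refl], rule sum.reindex_bij_betw[OF bij_betw_polar_transform])
  also have "\<dots> = mass k (minus_weights (2 ^ k) w) v"
    unfolding sum_words_prod by (simp add: mass_def minus_weights_def plus_weights_def)
  finally show ?thesis .
qed

text \<open>Once the first half is complete, s is a constant, and the paired factors form a product
  weight in t alone.\<close>

lemma mass_Suc_right:
  assumes "length x = 2 ^ k"
  shows "mass (Suc k) w (x @ v) = mass k (plus_weights (2 ^ k) w (polar_transform k x)) v"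
proof -
  let ?A = "{u. length u = 2 ^ k \<and> take (length v) u = v}"
  have *: "{u. length u = 2 ^ Suc k \<and> take (length (x @ v)) u = x @ v} = (@) x ` ?A"
  proof (intro equalityI subsetI)
    fix u assume "u \<in> {u. length u = 2 ^ Suc k \<and> take (length (x @ v)) u = x @ v}"
    then have u: "length u = 2 ^ Suc k" "take (2 ^ k + length v) u = x @ v" using assms by auto
    have "take (2 ^ k) u = take (2 ^ k) (take (2 ^ k + length v) u)" by simp
    then have "take (2 ^ k) u = x" unfolding u(2) using assms by simp
    moreover have "take (length v) (drop (2 ^ k) u) = v"
      using assms arg_cong[OF u(2), of "drop (2 ^ k)"] by (simp add: drop_take)
    ultimately have "u = x @ drop (2 ^ k) u" "drop (2 ^ k) u \<in> ?A"
      using append_take_drop_id[of "2 ^ k" u] u(1) by auto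
    then show "u \<in> (@) x ` ?A" by blast
  qed (use assms in auto)
  show ?thesis
    unfolding mass_def * using assms
    by (subst sum.reindex) (auto simp: inj_on_def prod_polar_transform_append simp del: power_Suc intro!: sum.cong)
qed

lemma mass_snoc:
  assumes "length v < 2 ^ k"
  shows "mass k w v = mass k w (v @ [0]) + mass k w (v @ [1])"
proof -
  have *: "{u. length u = 2 ^ k \<and> take (length v) u = v} =
     {u. length u = 2 ^ k \<and> take (length (v @ [0])) u = v @ [0]} \<union>
     {u. length u = 2 ^ k \<and> take (length (v @ [1])) u = v @ [1]}"
    using assms by (auto simp: take_Suc_conv_app_nth)
  show ?thesis unfolding mass_def *
    by (rule sum.union_disjoint) (auto simp: finite_words)
qed

text \<open>The denominator is written as a sum of two continuations because at a leaf of the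
  recursion it is then literally the sum of the two stored weights.\<close>

definition next_bit :: "(bit list \<Rightarrow> real) \<Rightarrow> bit option \<Rightarrow> bit list \<Rightarrow> bit pmf" where
  "next_bit \<mu> d v = (case d of
     Some x \<Rightarrow> return_pmf x
   | None \<Rightarrow> bernoulli_bit (\<mu> (v @ [1]) / (\<mu> (v @ [0]) + \<mu> (v @ [1]))))"

primrec sequential_sampler :: "(bit list \<Rightarrow> real) \<Rightarrow> (nat \<Rightarrow> bit option) \<Rightarrow> nat \<Rightarrow> bit list pmf" where
  "sequential_sampler \<mu> c 0 = return_pmf []"
| "sequential_sampler \<mu> c (Suc n) =
     bind_pmf (sequential_sampler \<mu> c n) (\<lambda>v. map_pmf (\<lambda>x. v @ [x]) (next_bit \<mu> (c n) v))"

text \<open>The result is the transformed word: the second call needs s in its weights, and the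
  caller needs (s + t, t). Bits of U occur only at the leaves, where the transform is the identity;
  \<open>c\<close> prescribes them.\<close>

primrec sc_sampler :: "nat \<Rightarrow> (nat \<Rightarrow> bit \<Rightarrow> real) \<Rightarrow> (nat \<Rightarrow> bit option) \<Rightarrow> bit list pmf" where
  "sc_sampler 0 w c = map_pmf (\<lambda>x. [x]) (case c 0 of
     Some x \<Rightarrow> return_pmf x
   | None \<Rightarrow> bernoulli_bit (w 0 1 / (w 0 0 + w 0 1)))"
| "sc_sampler (Suc k) w c =
     bind_pmf (sc_sampler k (minus_weights (2 ^ k) w) c) (\<lambda>s.
       map_pmf (\<lambda>t. map2 (+) s t @ t)
         (sc_sampler k (plus_weights (2 ^ k) w s) (\<lambda>i. c (2 ^ k + i))))"

lemma length_sequential_sampler: "v \<in> set_pmf (sequential_sampler \<mu> c n) \<Longrightarrow> length v = n"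
  by (induction n arbitrary: v) auto

text \<open>The restriction to short \<open>v\<close> matters, since \<open>mass_Suc_left\<close>
  only covers prefixes inside the first half.\<close>

lemma sequential_sampler_cong:
  assumes "\<And>v. length v \<le> n \<Longrightarrow> \<mu> v = \<mu>' v"
  shows "sequential_sampler \<mu> c n = sequential_sampler \<mu>' c n"
  using assms
proof (induction n)
  case (Suc n)
  have "sequential_sampler \<mu> c n = sequential_sampler \<mu>' c n" by (rule Suc.IH) (simp add: Suc.prems)
  then show ?case
    by (auto intro!: bind_pmf_cong simp: next_bit_def Suc.prems split: option.split
        dest: length_sequential_sampler)
qed simp

lemma sequential_sampler_add:
  "sequential_sampler \<mu> c (m + n) =
    bind_pmf (sequential_sampler \<mu> c m)
      (\<lambda>u. map_pmf ((@) u) (sequential_sampler (\<lambda>v. \<mu> (u @ v)) (\<lambda>i. c (m + i)) n))"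
proof (induction n)
  case (Suc n)
  then show ?case
    by (simp add: bind_assoc_pmf bind_map_pmf map_bind_pmf pmf.map_comp o_def next_bit_def
        cong: option.case_cong)
qed (simp add: bind_return_pmf')

text \<open>
  On a prefix of mass zero both sides form the same quotient 0 / 0 = 0.
\<close>

lemma sequential_sampler_mass:
  "map_pmf (polar_transform k) (sequential_sampler (mass k w) c (2 ^ k)) = sc_sampler k w c"
proof (induction k arbitrary: w c)
  case 0
  have 1: "{u :: bit list. length u = Suc 0 \<and> take (Suc 0) u = [x]} = {[x]}" for x
    by (auto simp: length_Suc_conv)
  show ?case
    by (simp add: bind_return_pmf next_bit_def pmf.map_comp o_def mass_def 1 split: option.split)
next
  case (Suc k)
  let ?n = "2 ^ k"
  have "map_pmf (polar_transform (Suc k)) (sequential_sampler (mass (Suc k) w) c (2 ^ Suc k)) =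
    bind_pmf (sequential_sampler (mass (Suc k) w) c ?n) (\<lambda>u.
      map_pmf (\<lambda>v. polar_transform (Suc k) (u @ v))
        (sequential_sampler (\<lambda>v. mass (Suc k) w (u @ v)) (\<lambda>i. c (?n + i)) ?n))"
    by (simp add: mult_2 sequential_sampler_add map_bind_pmf pmf.map_comp o_def)
  also have "\<dots> = bind_pmf (sequential_sampler (mass k (minus_weights ?n w)) c ?n) (\<lambda>u.
      map_pmf (\<lambda>v. map2 (+) (polar_transform k u) (polar_transform k v) @ polar_transform k v)
        (sequential_sampler (mass k (plus_weights ?n w (polar_transform k u))) (\<lambda>i. c (?n + i)) ?n))"
    by (intro bind_pmf_cong sequential_sampler_cong mass_Suc_left arg_cong2[where f = map_pmf] map_pmf_cong)
       (auto dest!: length_sequential_sampler simp: mass_Suc_right polar_transform_append)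
  \<comment> \<open>The second sampler depends on u only through its transform s, so u can be
    replaced by s and the induction hypothesis used for both halves.\<close>
  also have "\<dots> = bind_pmf (map_pmf (polar_transform k) (sequential_sampler (mass k (minus_weights ?n w)) c ?n)) (\<lambda>s.
      map_pmf (\<lambda>t. map2 (+) s t @ t) (map_pmf (polar_transform k)
        (sequential_sampler (mass k (plus_weights ?n w s)) (\<lambda>i. c (?n + i)) ?n)))"
    by (simp add: bind_map_pmf pmf.map_comp o_def)
  finally show ?case by (simp add: Suc.IH)
qed

section \<open>The shaper\<close>

lemma pmf_replicate_pmf:
  "pmf (replicate_pmf n q) u = (if length u = n then \<Prod>j<n. pmf q (u ! j) else 0)"
proof (induction n arbitrary: u)
  case (Suc n)
  have *: "replicate_pmf (Suc n) q = map_pmf (\<lambda>(x, u). x # u) (pair_pmf q (replicate_pmf n q))"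
    by (simp add: pair_pmf_def map_bind_pmf)
  show ?case
  proof (cases u)
    case (Cons x v)
    have "pmf (replicate_pmf (Suc n) q) u = pmf (pair_pmf q (replicate_pmf n q)) (x, v)"
      unfolding * Cons using pmf_map_inj'[of "\<lambda>(x, u). x # u" _ "(x, v)"] by (simp add: inj_def)
    then show ?thesis by (simp add: pmf_pair Suc.IH Cons prod.lessThan_Suc_shift del: prod.lessThan_Suc)
  qed (auto simp: pmf_eq_0_set_pmf set_replicate_pmf simp del: replicate_pmf.simps)
qed (auto simp: pmf_return)

lemma length_U_pmf: "u \<in> set_pmf (U_pmf p a) \<Longrightarrow> length u = 2 ^ a"
  by (auto simp: U_pmf_def)

text \<open>By the involution the only preimage of \<open>u\<close> in the support is
  \<open>polar_transform a u\<close>; intersecting with the support discards words of other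
  lengths.\<close>

lemma pmf_U_pmf:
  assumes "length u = 2 ^ a"
  shows "pmf (U_pmf p a) u = (\<Prod>j<2 ^ a. pmf (bernoulli_bit p) (polar_transform a u ! j))"
proof -
  let ?q = "replicate_pmf (2 ^ a) (bernoulli_bit p)"
  have "pmf (U_pmf p a) u = measure_pmf.prob ?q (polar_transform a -` {u} \<inter> set_pmf ?q)"
    by (simp add: U_pmf_def pmf_map measure_Int_set_pmf)
  also have "polar_transform a -` {u} \<inter> set_pmf ?q = {polar_transform a u} \<inter> set_pmf ?q"
    using assms by (auto simp: set_replicate_pmf polar_transform_involution)
  also have "measure_pmf.prob ?q \<dots> = pmf ?q (polar_transform a u)"
    by (simp add: measure_Int_set_pmf measure_pmf_single)
  finally show ?thesis by (simp add: pmf_replicate_pmf)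
qed

lemma prob_U_pmf_prefix:
  "measure_pmf.prob (U_pmf p a) {u. take (length v) u = v} = mass a (\<lambda>_. pmf (bernoulli_bit p)) v"
proof -
  let ?A = "{u :: bit list. length u = 2 ^ a \<and> take (length v) u = v}"
  have "measure_pmf.prob (U_pmf p a) {u. take (length v) u = v} = measure_pmf.prob (U_pmf p a) ?A"
    by (intro measure_pmf.finite_measure_eq_AE) (auto simp: AE_measure_pmf_iff length_U_pmf)
  also have "\<dots> = sum (pmf (U_pmf p a)) ?A"
    by (rule measure_measure_pmf_finite[OF finite_words])
  finally show ?thesis by (simp add: mass_def pmf_U_pmf)
qed

lemma pmf_bit_0: "pmf q 0 = 1 - pmf q 1" for q :: "bit pmf"
proof -
  have "sum (pmf q) UNIV = 1"
    by (intro sum_pmf_eq_1 subset_UNIV) (simp add: UNIV_bit)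
  then show ?thesis unfolding UNIV_bit by simp
qed

lemma pmf_bernoulli_bit_1: "p \<in> {0..1} \<Longrightarrow> pmf (bernoulli_bit p) 1 = p"
  using pmf_map_inj'[of "of_bool :: bool \<Rightarrow> bit" "bernoulli_pmf p" True]
  by (simp add: bernoulli_bit_def inj_def)

text \<open>A law on bits is determined by its mass at 1. This reduces the comparison of conditional
  laws to one number and recognizes point masses as Bernoulli laws.\<close>

lemma bernoulli_bit_pmf: "bernoulli_bit (pmf q 1) = q"
proof (rule pmf_eqI)
  fix x show "pmf (bernoulli_bit (pmf q 1)) x = pmf q x"
    by (cases x) (simp_all add: pmf_bit_0 pmf_bernoulli_bit_1 pmf_le_1)
qed

text \<open>The conditional mass at 1 is a quotient of two prefix probabilities, and
  \<open>mass_snoc\<close> splits its denominator. Meeting the support is what makes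
  \<open>cond_pmf\<close> a genuine conditional law.\<close>

lemma U_next_eq_next_bit:
  assumes v: "length v < 2 ^ a" and supp: "set_pmf (U_pmf p a) \<inter> {u. take (length v) u = v} \<noteq> {}"
  shows "U_next p a v = next_bit (mass a (\<lambda>_. pmf (bernoulli_bit p))) None v"
proof -
  let ?P = "U_pmf p a" and ?A = "{u. take (length v) u = v}" and ?\<mu> = "mass a (\<lambda>_. pmf (bernoulli_bit p))"
  have "pmf (U_next p a v) 1 = measure_pmf.prob (cond_pmf ?P ?A) {u. u ! length v = 1}"
    by (simp add: U_next_def pmf_map vimage_def)
  also have "\<dots> = measure_pmf.prob ?P (?A \<inter> {u. u ! length v = 1}) / measure_pmf.prob ?P ?A"
    using supp by (subst cond_pmf.rep_eq)
      (auto intro!: measure_uniform_measure simp: measure_pmf.emeasure_eq_measure measure_pmf_zero_iff)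
  also have "measure_pmf.prob ?P (?A \<inter> {u. u ! length v = 1}) =
      measure_pmf.prob ?P {u. take (length (v @ [1])) u = v @ [1]}"
    using v by (intro measure_pmf.finite_measure_eq_AE)
      (auto simp: AE_measure_pmf_iff take_Suc_conv_app_nth dest!: length_U_pmf)
  finally have "pmf (U_next p a v) 1 = ?\<mu> (v @ [1]) / (?\<mu> (v @ [0]) + ?\<mu> (v @ [1]))"
    unfolding prob_U_pmf_prefix using v by (simp add: mass_snoc)
  then show ?thesis
    by (metis bernoulli_bit_pmf next_bit_def option.simps(4))
qed

text \<open>
  Off the support of \<open>U_pmf\<close>, \<open>U_next\<close> is an unspecified distribution. The prefixes at which the
  shaper uses it do lie in the support: every prefix does if \<open>0 < p < 1\<close>, and for \<open>p = 0\<close> and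
  \<open>p = 1\<close> all entropies vanish, so that either all bits are prescribed or all bits are drawn.
\<close>

definition shaper_decision :: "nat set \<Rightarrow> bit list \<Rightarrow> nat \<Rightarrow> bit option" where
  "shaper_decision R u i = (if i \<in> R then Some (u ! card (R \<inter> {..<i})) else None)"

text \<open>Every bit is prescribed, so \<open>\<mu>\<close> is never consulted and may be
  arbitrary.\<close>

lemma shaper_prefix_full:
  assumes "{..<2 ^ a} \<subseteq> R" "n \<le> 2 ^ a"
  shows "shaper_prefix p a R u n = sequential_sampler \<mu> (shaper_decision R u) n"
  using assms(2)
proof (induction n)
  case (Suc n)
  then have "n \<in> R" using assms(1) by auto
  with Suc show ?case by (simp add: next_bit_def shaper_decision_def)
qed simp

lemma length_shaper_prefix: "v \<in> set_pmf (shaper_prefix p a R u n) \<Longrightarrow> length v = n"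
  by (induction n arbitrary: v) auto

text \<open>Isolates the one point where the two processes could differ: a bit drawn after a prefix
  outside the support.\<close>

lemma shaper_prefix_step:
  assumes "\<And>v. v \<in> set_pmf (shaper_prefix p a R u n) \<Longrightarrow>
      n \<notin> R \<Longrightarrow> set_pmf (U_pmf p a) \<inter> {u. take n u = v} \<noteq> {}"
    and "shaper_prefix p a R u n =
      sequential_sampler (mass a (\<lambda>_. pmf (bernoulli_bit p))) (shaper_decision R u) n"
    and "n < 2 ^ a"
  shows "shaper_prefix p a R u (Suc n) =
      sequential_sampler (mass a (\<lambda>_. pmf (bernoulli_bit p))) (shaper_decision R u) (Suc n)"
proof -
  have "map_pmf (\<lambda>c. v @ [c]) (if n \<in> R then return_pmf (u ! card (R \<inter> {..<n})) else U_next p a v) =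
     map_pmf (\<lambda>x. v @ [x])
       (next_bit (mass a (\<lambda>_. pmf (bernoulli_bit p))) (shaper_decision R u n) v)"
    if "v \<in> set_pmf (shaper_prefix p a R u n)" for v
    using assms(1)[OF that] length_shaper_prefix[OF that] assms(3)
      U_next_eq_next_bit[of v a p]
    by (auto simp: shaper_decision_def next_bit_def)
  then show ?thesis
    unfolding shaper_prefix.simps sequential_sampler.simps
    by (intro bind_pmf_cong) (simp_all add: assms(2))
qed

lemma shaper_prefix_positive:
  assumes p: "0 < p" "p < 1" and n: "n \<le> 2 ^ a"
  shows "shaper_prefix p a R u n =
      sequential_sampler (mass a (\<lambda>_. pmf (bernoulli_bit p))) (shaper_decision R u) n"
  using n
proof (induction n)
  case (Suc n)
  have pos: "pmf (bernoulli_bit p) x > 0" for x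
    using p by (cases x) (simp_all add: pmf_bit_0 pmf_bernoulli_bit_1)
  have "set_pmf (U_pmf p a) \<inter> {u. take n u = v} \<noteq> {}"
    if "v \<in> set_pmf (shaper_prefix p a R u n)" for v
  proof -
    note length_shaper_prefix[OF that]
    \<comment> \<open>All words of length 2^a have positive probability, so padding with zeros gives
      a supported extension.\<close>
    let ?w = "v @ replicate (2 ^ a - n) 0"
    have "pmf (U_pmf p a) ?w > 0"
      using \<open>length v = n\<close> Suc.prems by (subst pmf_U_pmf) (auto intro!: prod_pos pos)
    then have "?w \<in> set_pmf (U_pmf p a)" by (simp add: set_pmf_iff)
    with \<open>length v = n\<close> show ?thesis by auto
  qed
  then show ?case
    using Suc.IH Suc.prems by (intro shaper_prefix_step) simp_all
qed simp

text \<open>If every bit is drawn from the conditional laws, the process never leaves the support: a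
  bit of positive conditional probability comes from a supported word that extends the
  prefix.\<close>

lemma shaper_prefix_empty:
  assumes R: "R \<inter> {..<2 ^ a} = {}" and n: "n \<le> 2 ^ a"
  shows "shaper_prefix p a R u n =
      sequential_sampler (mass a (\<lambda>_. pmf (bernoulli_bit p))) (shaper_decision R u) n"
proof -
  have supp: "set_pmf (U_pmf p a) \<inter> {u. take m u = v} \<noteq> {}"
    if "v \<in> set_pmf (shaper_prefix p a R u m)" "m \<le> 2 ^ a" for m v
    using that
  proof (induction m arbitrary: v)
    case (Suc m)
    then obtain w c where w: "v = w @ [c]" "w \<in> set_pmf (shaper_prefix p a R u m)" "c \<in> set_pmf (U_next p a w)"
      using R by (auto split: if_splits)
    have lw: "length w = m" using length_shaper_prefix[OF w(2)] .
    have ne: "set_pmf (U_pmf p a) \<inter> {u. take (length w) u = w} \<noteq> {}" using Suc w(2) lw by auto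
    then obtain x where "x \<in> set_pmf (U_pmf p a)" "take m x = w" "x ! m = c"
      using w(3) lw by (auto simp: U_next_def set_cond_pmf)
    then show ?case using Suc.prems w(1) length_U_pmf[of x]
      by (auto simp: take_Suc_conv_app_nth intro!: exI[of _ x])
  qed (simp add: set_pmf_not_empty)
  show ?thesis using n
  proof (induction n)
    case (Suc n)
    then show ?case using supp by (intro shaper_prefix_step) auto
  qed simp
qed

section \<open>Entropies of constant random variables\<close>

lemma RN_deriv_return_pmf:
  fixes X :: "'a \<Rightarrow> 'b"
  assumes "countable (UNIV :: 'b set)"
  shows "RN_deriv (count_space UNIV) (distr (measure_pmf (return_pmf u)) (count_space UNIV) X) (X u) = 1"
    (is "RN_deriv ?N ?D _ = _")
proof -
  interpret sigma_finite_measure ?N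
    by (rule sigma_finite_measure_count_space_countable[OF assms])
  have "density ?N (indicator {X u}) = ?D"
  proof (rule measure_eqI)
    fix A assume "A \<in> sets (density ?N (indicator {X u}))"
    have "emeasure (density ?N (indicator {X u})) A = emeasure ?N ({X u} \<inter> A)"
      by (simp add: emeasure_density flip: indicator_inter_arith)
    also have "\<dots> = indicator A (X u)" by (cases "X u \<in> A") simp_all
    also have "\<dots> = emeasure ?D A" by (simp add: emeasure_distr indicator_def)
    finally show "emeasure (density ?N (indicator {X u})) A = emeasure ?D A" .
  qed simp
  \<comment> \<open>Uniqueness holds almost everywhere, which for the counting measure means at
    every point.\<close>
  then have "AE x in ?N. indicator {X u} x = RN_deriv ?N ?D x" by (intro RN_deriv_unique) simp_all
  then show ?thesis by (auto simp: AE_count_space dest!: spec[of _ "X u"])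
qed

text \<open>Conditional entropy integrates the logarithm of a quotient of Radon-Nikodym derivatives.
  A constant law evaluates both at the point it charges, where they equal 1.\<close>

lemma conditional_entropy_return_pmf:
  assumes "countable (UNIV :: 'b set)" "countable (UNIV :: 'c set)"
  shows "prob_space.conditional_entropy (measure_pmf (return_pmf u)) b
    (count_space UNIV) (count_space UNIV) (X :: 'a \<Rightarrow> 'b) (Y :: 'a \<Rightarrow> 'c) = 0"
proof -
  have *: "count_space (UNIV :: 'b set) \<Otimes>\<^sub>M count_space (UNIV :: 'c set) = count_space UNIV"
    using pair_measure_countable[OF assms] by simp
  have c: "countable (UNIV :: ('b \<times> 'c) set)"
    using countable_SIGMA[OF assms] by simp
  show ?thesis
    unfolding prob_space.conditional_entropy_def[OF prob_space_measure_pmf] *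
    by (subst integral_distr)
       (simp_all add: RN_deriv_return_pmf[OF assms(2)] RN_deriv_return_pmf[OF c, of u "\<lambda>x. (X x, Y x)"])
qed

lemma countable_bit: "countable (UNIV :: bit set)"
  by (simp add: UNIV_bit)

lemma countable_bit_list: "countable (UNIV :: bit list set)"
  using countable_lists[OF countable_bit] by simp

lemma U_entropy_degenerate:
  assumes "p = 0 \<or> p = 1"
  shows "U_entropy p a i = 0"
proof -
  obtain x where x: "bernoulli_bit p = return_pmf x"
    using assms bernoulli_bit_pmf[of "return_pmf 0"] bernoulli_bit_pmf[of "return_pmf 1"] by auto
  have "replicate_pmf n (return_pmf x) = return_pmf (replicate n x)" for n
    by (induction n) (simp_all add: bind_return_pmf)
  then show ?thesis
    by (simp add: U_entropy_def U_pmf_def x conditional_entropy_return_pmf countable_bit countable_bit_list)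
qed

lemma shaper_eq_sc_sampler:
  assumes "p \<in> {0..1}"
  shows "shaper p a (R_set p a \<epsilon>) u =
    sc_sampler a (\<lambda>_. pmf (bernoulli_bit p)) (shaper_decision (R_set p a \<epsilon>) u)"
proof -
  consider "0 < p" "p < 1" | "p = 0 \<or> p = 1" using assms by fastforce
  then have "shaper_prefix p a (R_set p a \<epsilon>) u (2 ^ a) =
      sequential_sampler (mass a (\<lambda>_. pmf (bernoulli_bit p))) (shaper_decision (R_set p a \<epsilon>) u) (2 ^ a)"
  proof cases
    case 2
    \<comment> \<open>Membership reduces to 0 \<ge> 1 - \<epsilon>, which is the same for every
      index.\<close>
    then have "R_set p a \<epsilon> = {..<2 ^ a} \<or> R_set p a \<epsilon> = {}"
      by (auto simp: R_set_def U_entropy_degenerate)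
    then show ?thesis using shaper_prefix_empty shaper_prefix_full by auto
  qed (simp add: shaper_prefix_positive)
  then show ?thesis by (simp add: shaper_def sequential_sampler_mass)
qed

section \<open>Programs\<close>

lemma run_append: "run (P @ Q) s = bind_pmf (run P s) (run Q)"
proof (induction P arbitrary: s)
  case (Cons c P)
  then have "run (P @ Q) = (\<lambda>s. bind_pmf (run P s) (run Q))" by blast
  then show ?case by (simp add: bind_assoc_pmf)
qed (simp add: bind_return_pmf)

lemma run_Nil: "run [] = return_pmf"
  by (rule ext) simp

text \<open>Meant for fragments without \<open>Draw\<close>: these end in a single memory, so an
  ordinary invariant indexed by the number of iterations suffices.\<close>

lemma run_loop:
  assumes "I 0 s"
    and "\<And>j s. j < n \<Longrightarrow> I j s \<Longrightarrow> \<exists>s'. run (f j) s = return_pmf s' \<and> I (Suc j) s'"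
  shows "\<exists>s'. run (concat (map f [0..<n])) s = return_pmf s' \<and> I n s'"
  using assms(2)
proof (induction n)
  case (Suc n)
  then obtain s' where "run (concat (map f [0..<n])) s = return_pmf s'" "I n s'"
    by (meson less_SucI)
  with Suc.prems[of n s'] show ?case by (auto simp: run_append bind_return_pmf)
qed (simp add: assms(1))

definition stores_weights :: "nat \<Rightarrow> (nat \<Rightarrow> bit \<Rightarrow> real) \<Rightarrow> nat \<Rightarrow> (nat \<Rightarrow> real) \<Rightarrow> bool" where
  "stores_weights n w r X \<longleftrightarrow> (\<forall>j<n. X (r + 2 * j) = w j 0 \<and> X (r + 2 * j + 1) = w j 1)"

text \<open>
  Real cell 0 holds \<open>p\<close>, the cells 1 and 2 are scratch, and weights are stored from cell 3 on. The
  weights of the recursive calls on half the length are placed behind those of the caller, which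
  must survive the first call.
\<close>

definition minus_step :: "nat \<Rightarrow> nat \<Rightarrow> nat \<Rightarrow> instr list" where
  "minus_step x y z =
     [Real_Mul 1 x y, Real_Mul 2 (x + 1) (y + 1), Real_Add z 1 2,
      Real_Mul 1 (x + 1) y, Real_Mul 2 x (y + 1), Real_Add (z + 1) 1 2]"

text \<open>Selection without a branch: if b is the bit s_j as a real number and x, x' are the two
  weights, then x + b (x' - x) and x' - b (x' - x) are x, x' in the order that b dictates.\<close>

definition plus_step :: "nat \<Rightarrow> nat \<Rightarrow> nat \<Rightarrow> nat \<Rightarrow> instr list" where
  "plus_step i x y z =
     [Real_Of_Bit 1 i, Real_Sub 2 (x + 1) x, Real_Mul 1 1 2,
      Real_Add 2 x 1, Real_Mul z 2 y, Real_Sub 2 (x + 1) 1, Real_Mul (z + 1) 2 (y + 1)]"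

definition minus_code :: "nat \<Rightarrow> nat \<Rightarrow> instr list" where
  "minus_code n r =
     concat (map (\<lambda>j. minus_step (r + 2 * j) (r + 2 * (n + j)) (r + 4 * n + 2 * j)) [0..<n])"

definition plus_code :: "nat \<Rightarrow> nat \<Rightarrow> nat \<Rightarrow> instr list" where
  "plus_code n r q =
     concat (map (\<lambda>j. plus_step (q + j) (r + 2 * j) (r + 2 * (n + j)) (r + 4 * n + 2 * j)) [0..<n])"

definition combine_code :: "nat \<Rightarrow> nat \<Rightarrow> instr list" where
  "combine_code n q = concat (map (\<lambda>j. [Bit_Add (q + j) (q + j) (q + n + j)]) [0..<n])"

primrec polar_code :: "nat \<Rightarrow> nat \<Rightarrow> instr list" where
  "polar_code 0 q = []"
| "polar_code (Suc k) q = polar_code k q @ polar_code k (q + 2 ^ k) @ combine_code (2 ^ k) q"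

text \<open>Here \<open>c\<close> holds addresses instead of bits, and its case distinction is
  resolved while the program is built. Multiplying a bit by itself copies it. Both calls reuse the
  area 4 n cells behind \<open>r\<close>, because the 2 n weights of the caller take two cells
  each.\<close>

primrec sc_code :: "nat \<Rightarrow> (nat \<Rightarrow> nat option) \<Rightarrow> nat \<Rightarrow> nat \<Rightarrow> instr list" where
  "sc_code 0 c r q = (case c 0 of
     Some i \<Rightarrow> [Bit_Mul q i i]
   | None \<Rightarrow> [Real_Add 1 r (r + 1), Real_Div 1 (r + 1) 1, Draw q 1])"
| "sc_code (Suc k) c r q =
     minus_code (2 ^ k) r @ sc_code k c (r + 4 * 2 ^ k) q @
     plus_code (2 ^ k) r q @ sc_code k (\<lambda>i. c (2 ^ k + i)) (r + 4 * 2 ^ k) (q + 2 ^ k) @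
     combine_code (2 ^ k) q"

text \<open>The bounds separate the operands from the scratch cells and from the targets, so writing
  \<open>z\<close> does not spoil the operands for \<open>z + 1\<close>.\<close>

lemma run_minus_step:
  assumes "3 \<le> x" "x + 1 < z" "3 \<le> y" "y + 1 < z"
  shows "\<exists>X'. run (minus_step x y z) (B, X) = return_pmf (B, X') \<and>
    X' z = X x * X y + X (x + 1) * X (y + 1) \<and> X' (z + 1) = X (x + 1) * X y + X x * X (y + 1) \<and>
    (\<forall>i. 3 \<le> i \<and> i \<noteq> z \<and> i \<noteq> z + 1 \<longrightarrow> X' i = X i)"
  using assms by (simp add: minus_step_def bind_return_pmf)

lemma run_plus_step:
  assumes "3 \<le> x" "x + 1 < z" "3 \<le> y" "y + 1 < z"
  shows "\<exists>X'. run (plus_step k x y z) (B, X) = return_pmf (B, X') \<and>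
    X' z = (if B k = 1 then X (x + 1) else X x) * X y \<and>
    X' (z + 1) = (if B k = 1 then X x else X (x + 1)) * X (y + 1) \<and>
    (\<forall>i. 3 \<le> i \<and> i \<noteq> z \<and> i \<noteq> z + 1 \<longrightarrow> X' i = X i)"
  using assms by (simp add: plus_step_def bind_return_pmf)

lemma run_minus_code:
  assumes r: "3 \<le> r" and w: "stores_weights (2 * n) w r X"
  shows "\<exists>X'. run (minus_code n r) (B, X) = return_pmf (B, X') \<and>
    stores_weights n (minus_weights n w) (r + 4 * n) X' \<and> (\<forall>i. 3 \<le> i \<and> i < r + 4 * n \<longrightarrow> X' i = X i)"
proof -
  let ?I = "\<lambda>m s'. fst s' = B \<and> stores_weights m (minus_weights n w) (r + 4 * n) (snd s') \<and>
     (\<forall>i. 3 \<le> i \<and> i < r + 4 * n \<longrightarrow> snd s' i = X i)"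
  have "\<exists>s'. run (minus_code n r) (B, X) = return_pmf s' \<and> ?I n s'"
    unfolding minus_code_def
  proof (rule run_loop[where I = ?I])
    fix j s' assume j: "j < n" and "?I j s'"
    then obtain X' where s': "s' = (B, X')" and X': "stores_weights j (minus_weights n w) (r + 4 * n) X'"
      "\<And>i. 3 \<le> i \<Longrightarrow> i < r + 4 * n \<Longrightarrow> X' i = X i" by (cases s') auto
    let ?x = "r + 2 * j" and ?y = "r + 2 * (n + j)" and ?z = "r + 4 * n + 2 * j"
    have *: "X' ?x = w j 0" "X' (?x + 1) = w j 1" "X' ?y = w (n + j) 0" "X' (?y + 1) = w (n + j) 1"
      using r j w[unfolded stores_weights_def, rule_format, of j]
        w[unfolded stores_weights_def, rule_format, of "n + j"]
      by (simp_all add: X'(2))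
    have "3 \<le> ?x" "?x + 1 < ?z" "3 \<le> ?y" "?y + 1 < ?z" using r j by simp_all
    from run_minus_step[OF this, of B X'] obtain X'' where
      X'': "run (minus_step ?x ?y ?z) (B, X') = return_pmf (B, X'')"
        "X'' ?z = minus_weights n w j 0" "X'' (?z + 1) = minus_weights n w j 1"
        "\<And>i. 3 \<le> i \<Longrightarrow> i \<noteq> ?z \<Longrightarrow> i \<noteq> ?z + 1 \<Longrightarrow> X'' i = X' i"
      unfolding * by (auto simp: minus_weights_def)
    have "stores_weights (Suc j) (minus_weights n w) (r + 4 * n) X''"
      using X'(1) r X''(2,3) by (auto simp: stores_weights_def less_Suc_eq X''(4))
    moreover have "X'' i = X i" if "3 \<le> i" "i < r + 4 * n" for i
      using that by (simp add: X'(2) X''(4))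
    ultimately show "\<exists>s''. run (minus_step ?x ?y ?z) s' = return_pmf s'' \<and> ?I (Suc j) s''"
      using X''(1) unfolding s' by (intro exI[of _ "(B, X'')"]) simp
  qed (simp add: stores_weights_def)
  then show ?thesis by auto
qed

lemma run_plus_code:
  assumes r: "3 \<le> r" and w: "stores_weights (2 * n) w r X" and b: "\<And>j. j < n \<Longrightarrow> B (q + j) = s ! j"
  shows "\<exists>X'. run (plus_code n r q) (B, X) = return_pmf (B, X') \<and>
    stores_weights n (plus_weights n w s) (r + 4 * n) X' \<and> (\<forall>i. 3 \<le> i \<and> i < r + 4 * n \<longrightarrow> X' i = X i)"
proof -
  let ?I = "\<lambda>m s'. fst s' = B \<and> stores_weights m (plus_weights n w s) (r + 4 * n) (snd s') \<and>
     (\<forall>i. 3 \<le> i \<and> i < r + 4 * n \<longrightarrow> snd s' i = X i)"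
  have "\<exists>s'. run (plus_code n r q) (B, X) = return_pmf s' \<and> ?I n s'"
    unfolding plus_code_def
  proof (rule run_loop[where I = ?I])
    fix j s' assume j: "j < n" and "?I j s'"
    then obtain X' where s': "s' = (B, X')" and X': "stores_weights j (plus_weights n w s) (r + 4 * n) X'"
      "\<And>i. 3 \<le> i \<Longrightarrow> i < r + 4 * n \<Longrightarrow> X' i = X i" by (cases s') auto
    let ?x = "r + 2 * j" and ?y = "r + 2 * (n + j)" and ?z = "r + 4 * n + 2 * j"
    have *: "X' ?x = w j 0" "X' (?x + 1) = w j 1" "X' ?y = w (n + j) 0" "X' (?y + 1) = w (n + j) 1"
      using r j w[unfolded stores_weights_def, rule_format, of j]
        w[unfolded stores_weights_def, rule_format, of "n + j"]
      by (simp_all add: X'(2))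
    have "3 \<le> ?x" "?x + 1 < ?z" "3 \<le> ?y" "?y + 1 < ?z" using r j by simp_all
    from run_plus_step[OF this, of "q + j" B X'] obtain X'' where
      X'': "run (plus_step (q + j) ?x ?y ?z) (B, X') = return_pmf (B, X'')"
        "X'' ?z = plus_weights n w s j 0" "X'' (?z + 1) = plus_weights n w s j 1"
        "\<And>i. 3 \<le> i \<Longrightarrow> i \<noteq> ?z \<Longrightarrow> i \<noteq> ?z + 1 \<Longrightarrow> X'' i = X' i"
      unfolding * b[OF j] by (cases "s ! j") (auto simp: plus_weights_def)
    have "stores_weights (Suc j) (plus_weights n w s) (r + 4 * n) X''"
      using X'(1) r X''(2,3) by (auto simp: stores_weights_def less_Suc_eq X''(4))
    moreover have "X'' i = X i" if "3 \<le> i" "i < r + 4 * n" for i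
      using that by (simp add: X'(2) X''(4))
    ultimately show "\<exists>s''. run (plus_step (q + j) ?x ?y ?z) s' = return_pmf s'' \<and> ?I (Suc j) s''"
      using X''(1) unfolding s' by (intro exI[of _ "(B, X'')"]) simp
  qed (simp add: stores_weights_def)
  then show ?thesis by auto
qed

lemma run_combine_code:
  "\<exists>B'. run (combine_code n q) (B, X) = return_pmf (B', X) \<and>
    (\<forall>j<n. B' (q + j) = B (q + j) + B (q + n + j)) \<and> (\<forall>i. i < q \<or> q + n \<le> i \<longrightarrow> B' i = B i)"
proof -
  let ?I = "\<lambda>m s. snd s = X \<and> (\<forall>j<m. fst s (q + j) = B (q + j) + B (q + n + j)) \<and>
    (\<forall>i. i < q \<or> q + m \<le> i \<longrightarrow> fst s i = B i)"
  have "\<exists>s'. run (combine_code n q) (B, X) = return_pmf s' \<and> ?I n s'"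
    unfolding combine_code_def
    by (rule run_loop[where I = ?I]) (auto simp: bind_return_pmf less_Suc_eq)
  then show ?thesis by auto
qed

lemma run_polar_code:
  "\<exists>B'. run (polar_code k q) (B, X) = return_pmf (B', X) \<and>
    map B' [q..<q + 2 ^ k] = polar_transform k (map B [q..<q + 2 ^ k]) \<and>
    (\<forall>i. i < q \<or> q + 2 ^ k \<le> i \<longrightarrow> B' i = B i)"
proof (induction k arbitrary: q B)
  case (Suc k)
  let ?n = "2 ^ k"
  obtain B1 where B1: "run (polar_code k q) (B, X) = return_pmf (B1, X)"
    "map B1 [q..<q + ?n] = polar_transform k (map B [q..<q + ?n])"
    "\<And>i. i < q \<or> q + ?n \<le> i \<Longrightarrow> B1 i = B i"
    using Suc.IH[of q B] by blast
  obtain B2 where B2: "run (polar_code k (q + ?n)) (B1, X) = return_pmf (B2, X)"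
    "map B2 [q + ?n..<q + ?n + ?n] = polar_transform k (map B1 [q + ?n..<q + ?n + ?n])"
    "\<And>i. i < q + ?n \<or> q + ?n + ?n \<le> i \<Longrightarrow> B2 i = B1 i"
    using Suc.IH[of "q + ?n" B1] by blast
  obtain B3 where B3: "run (combine_code ?n q) (B2, X) = return_pmf (B3, X)"
    "\<And>j. j < ?n \<Longrightarrow> B3 (q + j) = B2 (q + j) + B2 (q + ?n + j)"
    "\<And>i. i < q \<or> q + ?n \<le> i \<Longrightarrow> B3 i = B2 i"
    using run_combine_code[of ?n q B2 X] by blast
  have split: "[q..<q + 2 ^ Suc k] = [q..<q + ?n] @ [q + ?n..<q + ?n + ?n]"
    using upt_add_eq_append[of q "q + ?n" ?n] by (simp add: mult_2 add.assoc)
  have "map B1 [q + ?n..<q + ?n + ?n] = map B [q + ?n..<q + ?n + ?n]"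
       "map B2 [q..<q + ?n] = map B1 [q..<q + ?n]"
       "map B3 [q + ?n..<q + ?n + ?n] = map B2 [q + ?n..<q + ?n + ?n]"
    by (auto simp: B1(3) B2(3) B3(3))
  moreover have "map B3 [q..<q + ?n] = map2 (+) (map B2 [q..<q + ?n]) (map B2 [q + ?n..<q + ?n + ?n])"
    by (rule nth_equalityI) (simp_all add: B3(2))
  ultimately have "map B3 [q..<q + 2 ^ Suc k] = polar_transform (Suc k) (map B [q..<q + 2 ^ Suc k])"
    unfolding split map_append by (simp add: polar_transform_append B1(2) B2(2) del: map_eq_conv)
  moreover have "B3 i = B i" if "i < q \<or> q + 2 ^ Suc k \<le> i" for i
    using that by (auto simp: B1(3) B2(3) B3(3))
  ultimately show ?case by (auto simp: run_append bind_return_pmf B1(1) B2(1) B3(1))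
qed (auto simp: bind_return_pmf)

text \<open>The coupling relation between final memory and sampled word. It leaves open the scratch
  cells and the real cells behind the weights, whose contents may depend on the draws.\<close>

definition sc_result :: "nat \<Rightarrow> nat \<Rightarrow> nat \<Rightarrow> memory \<Rightarrow> memory \<Rightarrow> bit list \<Rightarrow> bool" where
  "sc_result n r q s s' x \<longleftrightarrow> map (fst s') [q..<q + n] = x \<and>
     (\<forall>i. i < q \<or> q + n \<le> i \<longrightarrow> fst s' i = fst s i) \<and>
     (\<forall>i. 3 \<le> i \<and> i < r + 2 * n \<longrightarrow> snd s' i = snd s i)"

text \<open>Program and sampler share one sequential structure, along which
  \<open>rel_pmf_bindI\<close> composes couplings. The last hypothesis keeps the prescribed bits
  outside the output area, so that they are intact when they are read.\<close>

lemma run_sc_code: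
  assumes "3 \<le> r" "stores_weights (2 ^ k) w r X"
    and "\<And>i. i < 2 ^ k \<Longrightarrow> d i = map_option B (c i)"
    and "\<And>i x. i < 2 ^ k \<Longrightarrow> c i = Some x \<Longrightarrow> x < q \<or> q + 2 ^ k \<le> x"
  shows "rel_pmf (sc_result (2 ^ k) r q (B, X)) (run (sc_code k c r q) (B, X)) (sc_sampler k w d)"
  using assms
proof (induction k arbitrary: w c d r q B X)
  case 0
  then have "X r = w 0 0" "X (Suc r) = w 0 1" "d 0 = map_option B (c 0)"
    by (simp_all add: stores_weights_def)
  then show ?case using 0
    by (cases "c 0") (auto simp: bind_return_pmf sc_result_def pmf.rel_map run_Nil bind_return_pmf'
       simp del: run.simps(1) intro!: pmf.rel_refl)
next
  case (Suc k)
  let ?n = "2 ^ k" and ?r = "r + 4 * 2 ^ k"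
  have w: "stores_weights (2 * ?n) w r X" using Suc.prems by simp
  obtain X1 where X1: "run (minus_code ?n r) (B, X) = return_pmf (B, X1)"
    "stores_weights ?n (minus_weights ?n w) ?r X1" "\<And>i. 3 \<le> i \<Longrightarrow> i < ?r \<Longrightarrow> X1 i = X i"
    using run_minus_code[OF Suc.prems(1) w] by blast
  have first: "rel_pmf (sc_result ?n ?r q (B, X1)) (run (sc_code k c ?r q) (B, X1))
      (sc_sampler k (minus_weights ?n w) d)"
  proof (rule Suc.IH[OF _ X1(2)])
    show "x < q \<or> q + ?n \<le> x" if "i < ?n" "c i = Some x" for i x
      using Suc.prems(4)[of i x] that by auto
  qed (use Suc.prems in auto)
  have rest: "rel_pmf (sc_result (2 ^ Suc k) r q (B, X))
      (run (plus_code ?n r q @ sc_code k (\<lambda>i. c (?n + i)) ?r (q + ?n) @ combine_code ?n q) s2)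
      (map_pmf (\<lambda>t. map2 (+) s t @ t) (sc_sampler k (plus_weights ?n w s) (\<lambda>i. d (?n + i))))"
    if s2: "sc_result ?n ?r q (B, X1) s2 s" for s2 s
  proof -
    obtain B2 X2 where s2_eq: "s2 = (B2, X2)" by (cases s2)
    have B2: "map B2 [q..<q + ?n] = s" "\<And>i. i < q \<or> q + ?n \<le> i \<Longrightarrow> B2 i = B i"
      and X2: "\<And>i. 3 \<le> i \<Longrightarrow> i < ?r \<Longrightarrow> X2 i = X i"
      using s2 X1(3) by (auto simp: sc_result_def s2_eq)
    \<comment> \<open>The caller's weights end at \<open>?r\<close>, and the first call changes no
      real cell from 3 up to there.\<close>
    have w2: "stores_weights (2 * ?n) w r X2"
      using w Suc.prems(1) by (auto simp: stores_weights_def X2)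
    have "B2 (q + j) = s ! j" if "j < ?n" for j using that by (simp flip: B2(1))
    then obtain X3 where X3: "run (plus_code ?n r q) (B2, X2) = return_pmf (B2, X3)"
      "stores_weights ?n (plus_weights ?n w s) ?r X3" "\<And>i. 3 \<le> i \<Longrightarrow> i < ?r \<Longrightarrow> X3 i = X2 i"
      using run_plus_code[OF Suc.prems(1) w2, of B2 q s] by blast
    have second: "rel_pmf (sc_result ?n ?r (q + ?n) (B2, X3))
        (run (sc_code k (\<lambda>i. c (?n + i)) ?r (q + ?n)) (B2, X3))
        (sc_sampler k (plus_weights ?n w s) (\<lambda>i. d (?n + i)))"
    proof (rule Suc.IH[OF _ X3(2)])
      fix i :: nat assume i: "i < ?n"
      \<comment> \<open>The addresses avoid both halves of the output, so the first call has not
        altered the bits that the second one copies.\<close>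
      have c: "x < q \<or> q + 2 * ?n \<le> x" if "c (?n + i) = Some x" for x
        using Suc.prems(4)[OF _ that] i by simp
      show "d (?n + i) = map_option B2 (c (?n + i))"
        using Suc.prems(3)[of "?n + i"] i c by (cases "c (?n + i)") (auto simp: B2(2))
      show "x < q + ?n \<or> q + ?n + ?n \<le> x" if "c (?n + i) = Some x" for x
        using c[OF that] by auto
    qed (use Suc.prems(1) in simp)
    have last: "rel_pmf (sc_result (2 ^ Suc k) r q (B, X)) (run (combine_code ?n q) s4)
        (return_pmf (map2 (+) s t @ t))"
      if s4: "sc_result ?n ?r (q + ?n) (B2, X3) s4 t" for s4 t
    proof -
      obtain B4 X4 where s4_eq: "s4 = (B4, X4)" by (cases s4)
      have B4: "map B4 [q + ?n..<q + ?n + ?n] = t"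
          "\<And>i. i < q + ?n \<or> q + ?n + ?n \<le> i \<Longrightarrow> B4 i = B2 i"
        and X4: "\<And>i. 3 \<le> i \<Longrightarrow> i < ?r \<Longrightarrow> X4 i = X i"
        using s4 X3(3) X2 by (auto simp: sc_result_def s4_eq)
      obtain B5 where B5: "run (combine_code ?n q) (B4, X4) = return_pmf (B5, X4)"
        "\<And>j. j < ?n \<Longrightarrow> B5 (q + j) = B4 (q + j) + B4 (q + ?n + j)"
        "\<And>i. i < q \<or> q + ?n \<le> i \<Longrightarrow> B5 i = B4 i"
        using run_combine_code[of ?n q B4 X4] by blast
      have split: "[q..<q + 2 ^ Suc k] = [q..<q + ?n] @ [q + ?n..<q + ?n + ?n]"
        using upt_add_eq_append[of q "q + ?n" ?n] by (simp add: mult_2 add.assoc)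
      have "map B5 [q..<q + ?n] = map2 (+) (map B4 [q..<q + ?n]) (map B4 [q + ?n..<q + ?n + ?n])"
        by (rule nth_equalityI) (simp_all add: B5(2))
      moreover have "map B4 [q..<q + ?n] = map B2 [q..<q + ?n]"
          "map B5 [q + ?n..<q + ?n + ?n] = map B4 [q + ?n..<q + ?n + ?n]"
        by (auto simp: B4(2) B5(3))
      ultimately have "map B5 [q..<q + 2 ^ Suc k] = map2 (+) s t @ t"
        unfolding split map_append by (simp only: B2(1) B4(1))
      moreover have "B5 i = B i" if "i < q \<or> q + 2 ^ Suc k \<le> i" for i
        using that by (auto simp: B2(2) B4(2) B5(3))
      ultimately show ?thesis
        unfolding s4_eq B5(1) by (auto simp: sc_result_def X4)
    qed
    show ?thesis
      unfolding s2_eq run_append X3(1) bind_return_pmf map_pmf_def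
      by (rule rel_pmf_bindI[OF second last])
  qed
  show ?case
    unfolding sc_code.simps sc_sampler.simps run_append[of "minus_code ?n r"] X1(1) bind_return_pmf
      run_append[of "sc_code k c ?r q"]
    by (rule rel_pmf_bindI[OF first rest])
qed

section \<open>The encoder\<close>

lemma concat_nth:
  assumes "i < length xss" "j < length (xss ! i)"
  shows "(\<Sum>i'<i. length (xss ! i')) + j < length (concat xss)"
    and "concat xss ! ((\<Sum>i'<i. length (xss ! i')) + j) = xss ! i ! j"
proof -
  have "(\<Sum>i'<i. length (xss ! i')) + j < length (concat xss) \<and>
      concat xss ! ((\<Sum>i'<i. length (xss ! i')) + j) = xss ! i ! j"
    using assms
  proof (induction xss arbitrary: i)
    case (Cons xs xss)
    show ?case
    proof (cases i)
      case (Suc i')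
      then show ?thesis using Cons.IH[of i'] Cons.prems
        by (simp add: sum.lessThan_Suc_shift nth_append add.assoc del: sum.lessThan_Suc)
    qed (use Cons.prems in \<open>auto simp: nth_append\<close>)
  qed simp
  then show "(\<Sum>i'<i. length (xss ! i')) + j < length (concat xss)"
    "concat xss ! ((\<Sum>i'<i. length (xss ! i')) + j) = xss ! i ! j" by auto
qed

lemma length_concat_sum: "length (concat xss) = (\<Sum>i<length xss. length (xss ! i))"
  by (simp add: length_concat sum_list_sum_nth lessThan_atLeast0)

definition input_address :: "nat \<Rightarrow> nat set list \<Rightarrow> nat \<Rightarrow> nat \<Rightarrow> nat" where
  "input_address n Fs i j =
     (if j \<in> Fs ! i then (\<Sum>i'<i. card (Fs ! i')) + card (Fs ! i \<inter> {..<j})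
      else (\<Sum>i'<length Fs. card (Fs ! i')) + ((\<Sum>i'<i. n - card (Fs ! i')) + card ({..<j} - Fs ! i)))"

lemma input_address:
  assumes "valid_input K n Fs fs ds" "i < K" "j < n"
  shows "input_address n Fs i j < length (concat fs @ concat ds)"
    and "(concat fs @ concat ds) ! input_address n Fs i j = outer_input n (Fs ! i) (fs ! i) (ds ! i) ! j"
proof -
  have len: "length Fs = K" "length fs = K" "length ds = K"
    and F: "Fs ! i \<subseteq> {..<n}" "length (fs ! i) = card (Fs ! i)" "length (ds ! i) = n - card (Fs ! i)"
    using assms by (auto simp: valid_input_def)
  have lf: "length (fs ! i') = card (Fs ! i')" and ld: "length (ds ! i') = n - card (Fs ! i')"
    if "i' < K" for i'
    using assms(1) that by (auto simp: valid_input_def)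
  have fin: "finite (Fs ! i)" using F(1) finite_subset by blast
  have "(\<Sum>i'<i. length (fs ! i')) = (\<Sum>i'<i. card (Fs ! i'))"
    "(\<Sum>i'<i. length (ds ! i')) = (\<Sum>i'<i. n - card (Fs ! i'))"
    using assms(2) by (auto intro!: sum.cong simp: lf ld)
  moreover have "length (concat fs) = (\<Sum>i'<length Fs. card (Fs ! i'))"
    by (simp add: length_concat_sum len lf)
  moreover have "card (Fs ! i \<inter> {..<j}) < length (fs ! i)" if "j \<in> Fs ! i"
    unfolding F(2) by (rule psubset_card_mono[OF fin]) (use that in auto)
  moreover have "card ({..<j} - Fs ! i) < length (ds ! i)" if "j \<notin> Fs ! i"
  proof -
    have "card ({..<j} - Fs ! i) < card ({..<n} - Fs ! i)"
      by (rule psubset_card_mono) (use that assms(3) in auto)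
    then show ?thesis using F fin by (simp add: card_Diff_subset)
  qed
  ultimately have "input_address n Fs i j < length (concat fs @ concat ds) \<and>
    (concat fs @ concat ds) ! input_address n Fs i j = outer_input n (Fs ! i) (fs ! i) (ds ! i) ! j"
    using concat_nth[of i fs "card (Fs ! i \<inter> {..<j})"] concat_nth[of i ds "card ({..<j} - Fs ! i)"]
      assms(2,3) len
    by (auto simp: input_address_def outer_input_def nth_append)
  then show "input_address n Fs i j < length (concat fs @ concat ds)"
    "(concat fs @ concat ds) ! input_address n Fs i j = outer_input n (Fs ! i) (fs ! i) (ds ! i) ! j"
    by auto
qed

lemma length_input:
  assumes "valid_input K n Fs fs ds"
  shows "length (concat fs @ concat ds) = K * n"
proof -
  have len: "length fs = K" "length ds = K"
    and lf: "length (fs ! i) + length (ds ! i) = n" if "i < K" for i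
    using assms card_mono[of "{..<n}" "Fs ! i"] that by (auto simp: valid_input_def)
  have "length (concat fs @ concat ds) = (\<Sum>i<K. length (fs ! i) + length (ds ! i))"
    using assms by (simp add: length_concat_sum sum.distrib valid_input_def)
  also have "\<dots> = (\<Sum>i<K. n)" by (intro sum.cong) (auto simp: lf)
  finally show ?thesis by simp
qed

definition outer_code :: "nat \<Rightarrow> nat \<Rightarrow> nat set list \<Rightarrow> instr list" where
  "outer_code b N Fs = concat (map (\<lambda>i.
     concat (map (\<lambda>j. [Bit_Mul (N + i * 2 ^ b + j)
        (input_address (2 ^ b) Fs i j) (input_address (2 ^ b) Fs i j)]) [0..<2 ^ b]) @
     polar_code b (N + i * 2 ^ b)) [0..<length Fs])"

lemma run_copy:
  assumes "\<And>j. j < n \<Longrightarrow> f j < q"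
  shows "\<exists>B'. run (concat (map (\<lambda>j. [Bit_Mul (q + j) (f j) (f j)]) [0..<n])) (B, X) = return_pmf (B', X) \<and>
    (\<forall>j<n. B' (q + j) = B (f j)) \<and> (\<forall>i. i < q \<or> q + n \<le> i \<longrightarrow> B' i = B i)"
proof -
  let ?I = "\<lambda>m s. snd s = X \<and> (\<forall>j<m. fst s (q + j) = B (f j)) \<and>
    (\<forall>i. i < q \<or> q + m \<le> i \<longrightarrow> fst s i = B i)"
  have idem: "x * x = x" for x :: bit by (cases x) simp_all
  have "\<exists>s'. run (concat (map (\<lambda>j. [Bit_Mul (q + j) (f j) (f j)]) [0..<n])) (B, X) = return_pmf s' \<and> ?I n s'"
    by (rule run_loop[where I = ?I]) (use assms in \<open>auto simp: bind_return_pmf less_Suc_eq idem\<close>)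
  then show ?thesis by auto
qed

lemma nth_outer_encoder:
  "i < length Fs \<Longrightarrow> outer_encoder b Fs fs ds ! i =
    polar_transform b (outer_input (2 ^ b) (Fs ! i) (fs ! i) (ds ! i))"
  by (simp add: outer_encoder_def)

lemma run_outer_code:
  assumes valid: "valid_input K (2 ^ b) Fs fs ds"
    and N: "K * 2 ^ b \<le> N"
    and B: "\<And>i. i < K * 2 ^ b \<Longrightarrow> B i = (concat fs @ concat ds) ! i"
  shows "\<exists>B'. run (outer_code b N Fs) (B, X) = return_pmf (B', X) \<and>
    (\<forall>i<K. map B' [N + i * 2 ^ b..<N + i * 2 ^ b + 2 ^ b] = outer_encoder b Fs fs ds ! i)"
proof -
  let ?M = "2 ^ b :: nat"
  \<comment> \<open>Cells below \<open>N\<close> stay unchanged, so each outer code still finds its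
    input there.\<close>
  let ?I = "\<lambda>m s. snd s = X \<and> (\<forall>i<N. fst s i = B i) \<and>
    (\<forall>i<m. map (fst s) [N + i * ?M..<N + i * ?M + ?M] = outer_encoder b Fs fs ds ! i)"
  have K: "length Fs = K" using valid by (simp add: valid_input_def)
  have "\<exists>s'. run (outer_code b N Fs) (B, X) = return_pmf s' \<and> ?I (length Fs) s'"
    unfolding outer_code_def
  proof (rule run_loop[where I = ?I])
    fix i s assume i: "i < length Fs" and "?I i s"
    then obtain B1 where s: "s = (B1, X)" and B1: "\<And>i. i < N \<Longrightarrow> B1 i = B i"
      "\<And>i'. i' < i \<Longrightarrow> map B1 [N + i' * ?M..<N + i' * ?M + ?M] = outer_encoder b Fs fs ds ! i'"
      by (cases s) auto
    let ?q = "N + i * ?M" and ?f = "input_address ?M Fs i"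
    have f: "?f j < K * ?M" "B (?f j) = outer_input ?M (Fs ! i) (fs ! i) (ds ! i) ! j" if "j < ?M" for j
      using input_address[OF valid _ that, of i] i K length_input[OF valid] by (simp_all add: B)
    have "?f j < ?q" if "j < ?M" for j using f(1)[OF that] N by simp
    from run_copy[where f = ?f, OF this, of ?M B1 X] obtain B2 where
      B2: "run (concat (map (\<lambda>j. [Bit_Mul (?q + j) (?f j) (?f j)]) [0..<?M])) (B1, X) = return_pmf (B2, X)"
        "\<And>j. j < ?M \<Longrightarrow> B2 (?q + j) = B1 (?f j)" "\<And>i. i < ?q \<or> ?q + ?M \<le> i \<Longrightarrow> B2 i = B1 i"
      by blast
    obtain B3 where B3: "run (polar_code b ?q) (B2, X) = return_pmf (B3, X)"
      "map B3 [?q..<?q + ?M] = polar_transform b (map B2 [?q..<?q + ?M])"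
      "\<And>i. i < ?q \<or> ?q + ?M \<le> i \<Longrightarrow> B3 i = B2 i"
      using run_polar_code[of b ?q B2 X] by blast
    have "map B2 [?q..<?q + ?M] = outer_input ?M (Fs ! i) (fs ! i) (ds ! i)"
    proof (rule nth_equalityI)
      fix j assume "j < length (map B2 [?q..<?q + ?M])"
      then have j: "j < ?M" by simp
      then have "B1 (?f j) = B (?f j)" using f(1)[OF j] N by (intro B1) simp
      with j show "map B2 [?q..<?q + ?M] ! j = outer_input ?M (Fs ! i) (fs ! i) (ds ! i) ! j"
        by (simp add: B2(2) f(2))
    qed (simp add: outer_input_def)
    then have new: "map B3 [?q..<?q + ?M] = outer_encoder b Fs fs ds ! i"
      using i by (simp add: B3(2) nth_outer_encoder del: map_eq_conv)
    have old: "map B3 [N + i' * ?M..<N + i' * ?M + ?M] = outer_encoder b Fs fs ds ! i'" if "i' < i" for i'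
    proof -
      have "i' * ?M + ?M \<le> i * ?M" using that mult_le_mono1[of "Suc i'" i ?M] by simp
      then have "map B3 [N + i' * ?M..<N + i' * ?M + ?M] = map B1 [N + i' * ?M..<N + i' * ?M + ?M]"
        by (auto simp: B3(3) B2(3))
      then show ?thesis using B1(2)[OF that] by simp
    qed
    show "\<exists>s'. run (concat (map (\<lambda>j. [Bit_Mul (?q + j) (?f j) (?f j)]) [0..<?M]) @ polar_code b ?q) s
        = return_pmf s' \<and> ?I (Suc i) s'"
    proof (intro exI conjI)
      show "run (concat (map (\<lambda>j. [Bit_Mul (?q + j) (?f j) (?f j)]) [0..<?M]) @ polar_code b ?q) s = return_pmf (B3, X)"
        by (simp only: s run_append B2(1) B3(1) bind_return_pmf)
      show "\<forall>i'<Suc i. map (fst (B3, X)) [N + i' * ?M..<N + i' * ?M + ?M] = outer_encoder b Fs fs ds ! i'"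
        using new old by (simp add: less_Suc_eq del: map_eq_conv)
    qed (simp_all add: B3(3) B2(3) B1(1))
  qed simp
  then show ?thesis unfolding K by auto
qed

text \<open>Programs contain no real constants: the number 1 is converted from a bit. It yields 1 -
  p, and multiplication by it copies real cells.\<close>

definition weights_code :: "nat \<Rightarrow> nat \<Rightarrow> instr list" where
  "weights_code z n = [Bit_Const z 1, Real_Of_Bit 1 z, Real_Sub 2 1 0] @
     concat (map (\<lambda>j. [Real_Mul (3 + 2 * j) 1 2, Real_Mul (3 + 2 * j + 1) 1 0]) [0..<n])"

lemma run_weights_code:
  assumes "p \<in> {0..1}" "X 0 = p"
  shows "\<exists>X'. run (weights_code z n) (B, X) = return_pmf (B(z := 1), X') \<and>
    stores_weights n (\<lambda>_. pmf (bernoulli_bit p)) 3 X'"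
proof -
  let ?X = "X(1 := 1, 2 := 1 - p)"
  let ?I = "\<lambda>m s. fst s = B(z := 1) \<and> snd s 0 = p \<and> snd s 1 = 1 \<and> snd s 2 = 1 - p \<and>
    stores_weights m (\<lambda>_. pmf (bernoulli_bit p)) 3 (snd s)"
  have "\<exists>s'. run (concat (map (\<lambda>j. [Real_Mul (3 + 2 * j) 1 2, Real_Mul (3 + 2 * j + 1) 1 0]) [0..<n]))
      (B(z := 1), ?X) = return_pmf s' \<and> ?I n s'"
  proof (rule run_loop[where I = ?I])
    fix j s assume "?I j s"
    then show "\<exists>s'. run [Real_Mul (3 + 2 * j) 1 2, Real_Mul (3 + 2 * j + 1) 1 0] s = return_pmf s' \<and> ?I (Suc j) s'"
      using assms(1)
      by (cases s) (auto simp: bind_return_pmf stores_weights_def less_Suc_eq pmf_bit_0 pmf_bernoulli_bit_1)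
  qed (use assms(2) in \<open>auto simp: stores_weights_def\<close>)
  then show ?thesis
    using assms(2) by (auto simp: weights_code_def run_append bind_return_pmf)
qed

text \<open>The outer codewords are stored as rows of length \<open>M\<close>, and block
  \<open>m\<close> reads column \<open>m\<close>.\<close>

definition block_address :: "nat set \<Rightarrow> nat \<Rightarrow> nat \<Rightarrow> nat \<Rightarrow> nat \<Rightarrow> nat option" where
  "block_address R N M m i = (if i \<in> R then Some (N + card (R \<inter> {..<i}) * M + m) else None)"

definition blocks_code :: "nat \<Rightarrow> nat \<Rightarrow> nat set \<Rightarrow> nat \<Rightarrow> nat \<Rightarrow> instr list" where
  "blocks_code a n R N m = concat (map (\<lambda>m. sc_code a (block_address R N n m) 3 (m * 2 ^ a)) [0..<m])"

text \<open>Both frame conditions serve the next block, which reads the codewords from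
  \<open>N\<close> on and the same initial weights; these are therefore computed only once.\<close>

definition blocks_result :: "nat \<Rightarrow> nat \<Rightarrow> nat \<Rightarrow> memory \<Rightarrow> memory \<Rightarrow> (nat \<Rightarrow> bit list) \<Rightarrow> bool" where
  "blocks_result L N m s s' x \<longleftrightarrow> map (fst s') [0..<m * L] = concat (map x [0..<m]) \<and>
     (\<forall>i\<ge>N. fst s' i = fst s i) \<and> (\<forall>i. 3 \<le> i \<and> i < 3 + 2 * L \<longrightarrow> snd s' i = snd s i)"

lemma run_blocks_code:
  assumes w: "stores_weights (2 ^ a) w 3 X" and N: "m * 2 ^ a \<le> N"
    and d: "\<And>m' i. m' < m \<Longrightarrow> i < 2 ^ a \<Longrightarrow> d m' i = map_option B (block_address R N n m' i)"
  shows "rel_pmf (blocks_result (2 ^ a) N m (B, X)) (run (blocks_code a n R N m) (B, X))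
    (Pi_pmf {..<m} [] (\<lambda>m. sc_sampler a w (d m)))"
  using N d
proof (induction m)
  case 0
  then show ?case by (simp add: blocks_code_def blocks_result_def)
next
  case (Suc m)
  let ?L = "2 ^ a :: nat" and ?c = "block_address R N n m"
  \<comment> \<open>Inserting an index draws the new block before the others; commuting the two
    draws matches the program, which runs block \<open>m\<close> last.\<close>
  have Pi: "Pi_pmf {..<Suc m} [] (\<lambda>m. sc_sampler a w (d m)) =
      bind_pmf (Pi_pmf {..<m} [] (\<lambda>m. sc_sampler a w (d m))) (\<lambda>x.
        bind_pmf (sc_sampler a w (d m)) (\<lambda>y. return_pmf (x(m := y))))"
    by (subst bind_commute_pmf) (simp add: lessThan_Suc Pi_pmf_insert')
  have step: "rel_pmf (blocks_result ?L N (Suc m) (B, X)) (run (sc_code a ?c 3 (m * ?L)) s')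
      (bind_pmf (sc_sampler a w (d m)) (\<lambda>y. return_pmf (x(m := y))))"
    if "blocks_result ?L N m (B, X) s' x" for s' x
  proof -
    obtain B' X' where s': "s' = (B', X')" by (cases s')
    have r: "map B' [0..<m * ?L] = concat (map x [0..<m])"
      "\<And>i. N \<le> i \<Longrightarrow> B' i = B i" "\<And>i. 3 \<le> i \<Longrightarrow> i < 3 + 2 * ?L \<Longrightarrow> X' i = X i"
      using that by (auto simp: blocks_result_def s')
    have "rel_pmf (sc_result ?L 3 (m * ?L) (B', X')) (run (sc_code a ?c 3 (m * ?L)) (B', X'))
        (sc_sampler a w (d m))"
    proof (rule run_sc_code)
      show "stores_weights ?L w 3 X'" using w by (simp add: stores_weights_def r(3))
      show "d m i = map_option B' (?c i)" if "i < ?L" for i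
        using Suc.prems(2)[OF _ that, of m] by (simp add: block_address_def r(2))
      show "y < m * ?L \<or> m * ?L + ?L \<le> y" if "?c i = Some y" for i y
        using that Suc.prems(1) by (auto simp: block_address_def split: if_splits)
    qed simp
    then have "rel_pmf (\<lambda>s y. blocks_result ?L N (Suc m) (B, X) s (x(m := y)))
        (run (sc_code a ?c 3 (m * ?L)) (B', X')) (sc_sampler a w (d m))"
    proof (rule pmf.rel_mono_strong)
      fix s'' y assume "sc_result ?L 3 (m * ?L) (B', X') s'' y"
      then have y: "map (fst s'') [m * ?L..<m * ?L + ?L] = y"
        "\<And>i. i < m * ?L \<or> m * ?L + ?L \<le> i \<Longrightarrow> fst s'' i = B' i"
        "\<And>i. 3 \<le> i \<Longrightarrow> i < 3 + 2 * ?L \<Longrightarrow> snd s'' i = X' i"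
        by (auto simp: sc_result_def)
      have "[0..<Suc m * ?L] = [0..<m * ?L] @ [m * ?L..<m * ?L + ?L]"
        using upt_add_eq_append[of 0 "m * ?L" ?L] by (simp add: add.commute)
      moreover have "map (fst s'') [0..<m * ?L] = concat (map x [0..<m])"
        unfolding r(1)[symmetric] using y(2) by simp
      moreover have "map (x(m := y)) [0..<m] = map x [0..<m]" by simp
      ultimately have "map (fst s'') [0..<Suc m * ?L] = concat (map (x(m := y)) [0..<Suc m])"
        using y(1) by (simp del: map_eq_conv)
      then show "blocks_result ?L N (Suc m) (B, X) s'' (x(m := y))"
        using Suc.prems(1) by (simp add: blocks_result_def y(2,3) r(2,3))
    qed
    then show ?thesis unfolding s' by (simp add: pmf.rel_map flip: map_pmf_def)
  qed
  have "blocks_code a n R N (Suc m) = blocks_code a n R N m @ sc_code a ?c 3 (m * ?L)"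
    by (simp add: blocks_code_def)
  then show ?case
    unfolding Pi run_append
    using rel_pmf_bindI[OF Suc.IH step] Suc.prems by (simp add: run_append)
qed

text \<open>
  The input occupies bit cells below \<open>N\<close>; the outer codewords are written to the cells from \<open>N\<close> on,
  so that the blocks can then overwrite the input.
\<close>

definition encoder_code :: "nat \<Rightarrow> nat \<Rightarrow> nat set \<Rightarrow> nat set list \<Rightarrow> instr list" where
  "encoder_code a b R Fs =
     (let N = 2 ^ a * 2 ^ b in outer_code b N Fs @ weights_code (2 * N) (2 ^ a) @ blocks_code a (2 ^ b) R N (2 ^ b))"

text \<open>Turns a coupling back into an equation of laws once only the output is observed.\<close>

lemma map_pmf_eq_of_rel_pmf:
  assumes "rel_pmf R p q" "\<And>x y. R x y \<Longrightarrow> f x = g y"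
  shows "map_pmf f p = map_pmf g q"
proof -
  have "rel_pmf (=) (map_pmf f p) (map_pmf g q)"
    unfolding pmf.rel_map using assms by (rule pmf.rel_mono_strong)
  then show ?thesis by (simp add: pmf.rel_eq)
qed

lemma program_output_encoder_code:
  assumes p: "p \<in> {0..1}" and valid: "valid_input (card (R_set p a \<epsilon>)) (2 ^ b) Fs fs ds"
  shows "program_output (encoder_code a b (R_set p a \<epsilon>) Fs) (2 ^ a * 2 ^ b) p (concat fs @ concat ds) =
    encoder p \<epsilon> a b Fs fs ds"
proof -
  define R where "R = R_set p a \<epsilon>"
  define N :: nat where "N = 2 ^ a * 2 ^ b"
  let ?L = "2 ^ a :: nat" and ?M = "2 ^ b :: nat" and ?K = "card R"
  let ?w = "\<lambda>_ :: nat. pmf (bernoulli_bit p)" and ?vs = "outer_encoder b Fs fs ds"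
  have R: "R \<subseteq> {..<?L}" by (auto simp: R_def R_set_def)
  then have finR: "finite R" and K: "?K \<le> ?L"
    using finite_subset card_mono[OF _ R] by auto
  have KM: "?K * ?M \<le> N" using K by (simp add: N_def)
  note valid = valid[folded R_def]
  obtain B0 X0 where init: "initial_memory p (concat fs @ concat ds) = (B0, X0)" "X0 0 = p"
    "\<And>i. i < ?K * ?M \<Longrightarrow> B0 i = (concat fs @ concat ds) ! i"
    using length_input[OF valid] by (simp add: initial_memory_def del: length_append)
  obtain B1 where B1: "run (outer_code b N Fs) (B0, X0) = return_pmf (B1, X0)"
    "\<And>i. i < ?K \<Longrightarrow> map B1 [N + i * ?M..<N + i * ?M + ?M] = ?vs ! i"
    using run_outer_code[OF valid KM init(3), where X = X0] by blast
  obtain X2 where X2: "run (weights_code (2 * N) ?L) (B1, X0) = return_pmf (B1(2 * N := 1), X2)"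
    "stores_weights ?L ?w 3 X2"
    using run_weights_code[where X = X0, OF p init(2)] by blast
  let ?B2 = "B1(2 * N := 1)"
  let ?d = "\<lambda>m. shaper_decision R (map (\<lambda>v. v ! m) ?vs)"
  have lenvs: "length ?vs = ?K" using valid by (simp add: outer_encoder_def valid_input_def)
  have d: "?d m i = map_option ?B2 (block_address R N ?M m i)" if m: "m < ?M" for m i
  proof (cases "i \<in> R")
    case True
    let ?r = "card (R \<inter> {..<i})"
    have r: "?r < ?K" by (rule psubset_card_mono[OF finR]) (use True in auto)
    have "Suc ?r * ?M \<le> ?K * ?M" using r by (intro mult_le_mono1) simp
    \<comment> \<open>Cell \<open>2 * N\<close>, overwritten by \<open>weights_code\<close>, lies
      behind all codewords.\<close>
    then have "N + ?r * ?M + m < 2 * N" using m KM by simp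
    moreover have "B1 (N + ?r * ?M + m) = ?vs ! ?r ! m"
      using m by (simp flip: B1(2)[OF r])
    ultimately show ?thesis using True r lenvs by (simp add: shaper_decision_def block_address_def)
  qed (simp add: shaper_decision_def block_address_def)
  have "rel_pmf (blocks_result ?L N ?M (?B2, X2)) (run (blocks_code a ?M R N ?M) (?B2, X2))
      (Pi_pmf {..<?M} [] (\<lambda>m. sc_sampler a ?w (?d m)))"
    by (rule run_blocks_code[OF X2(2)]) (simp_all add: N_def d del: fun_upd_apply)
  then have "map_pmf (\<lambda>(B, X). map B [0..<N]) (run (blocks_code a ?M R N ?M) (?B2, X2)) =
      map_pmf (\<lambda>x. concat (map x [0..<?M])) (Pi_pmf {..<?M} [] (\<lambda>m. sc_sampler a ?w (?d m)))"
    by (rule map_pmf_eq_of_rel_pmf) (auto simp: blocks_result_def N_def mult.commute)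
  moreover have "sc_sampler a ?w (?d m) = shaper p a R (map (\<lambda>v. v ! m) ?vs)" for m
    using shaper_eq_sc_sampler[OF p] by (simp add: R_def)
  ultimately show ?thesis
    by (simp add: program_output_def encoder_code_def Let_def encoder_def inner_encoder_def init(1)
        run_append B1(1) X2(1) bind_return_pmf flip: R_def N_def)
qed

section \<open>Operation counts\<close>

lemma length_loop: "(\<And>j. j < n \<Longrightarrow> length (f j) = l) \<Longrightarrow> length (concat (map f [0..<n])) = n * l"
  by (induction n) simp_all

lemma length_polar_code: "length (polar_code k q) \<le> k * 2 ^ k"
proof (induction k arbitrary: q)
  case (Suc k)
  have "length (combine_code (2 ^ k) q) = 2 ^ k"
    unfolding combine_code_def by (subst length_loop[where l = 1]) simp_all
  then show ?case using Suc[of q] Suc[of "q + 2 ^ k"] by simp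
qed simp

text \<open>A call on length 2 n spends 6 + 7 + 1 = 14 instructions on each of n pairs, that is 7
  per position and level; a leaf takes at most 3.\<close>

lemma length_sc_code: "length (sc_code k c r q) \<le> (7 * k + 3) * 2 ^ k"
proof (induction k arbitrary: c r q)
  case (Suc k)
  have "length (minus_code (2 ^ k) r) = 2 ^ k * 6" "length (plus_code (2 ^ k) r q) = 2 ^ k * 7"
    "length (combine_code (2 ^ k) q) = 2 ^ k * 1"
    unfolding minus_code_def plus_code_def combine_code_def
    by (rule length_loop; simp add: minus_step_def plus_step_def)+
  then show ?case
    using Suc[of c "r + 4 * 2 ^ k" q] Suc[of "\<lambda>i. c (2 ^ k + i)" "r + 4 * 2 ^ k" "q + 2 ^ k"]
    by (simp add: algebra_simps)
qed (auto split: option.split)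

lemma length_loop_le:
  "(\<And>j. j < n \<Longrightarrow> length (f j) \<le> l) \<Longrightarrow> length (concat (map f [0..<n])) \<le> n * l"
proof (induction n)
  case (Suc n)
  then have "length (concat (map f [0..<n])) \<le> n * l" "length (f n) \<le> l" by simp_all
  then show ?case by simp
qed simp

text \<open>Per output bit, 9 = 1 + 5 + 3 accounts for copying the input, preparing the weights and
  the leaves; the outer levels cost at most b and the inner ones 7 a.\<close>

lemma length_encoder_code:
  assumes "length Fs \<le> 2 ^ a"
  shows "length (encoder_code a b R Fs) \<le> 2 ^ a * 2 ^ b * (9 + 7 * (a + b))"
proof -
  let ?L = "2 ^ a :: nat" and ?M = "2 ^ b :: nat"
  have "length (outer_code b N Fs) \<le> length Fs * (?M + b * ?M)" for N
    unfolding outer_code_def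
  proof (rule length_loop_le)
    fix i
    have "length (concat (map (\<lambda>j. [Bit_Mul (N + i * ?M + j) (input_address ?M Fs i j)
        (input_address ?M Fs i j)]) [0..<?M])) = ?M * 1"
      by (rule length_loop) simp
    then show "length (concat (map (\<lambda>j. [Bit_Mul (N + i * ?M + j) (input_address ?M Fs i j)
        (input_address ?M Fs i j)]) [0..<?M]) @ polar_code b (N + i * ?M)) \<le> ?M + b * ?M"
      using length_polar_code[of b "N + i * ?M"] by simp
  qed
  also have "length Fs * (?M + b * ?M) \<le> ?L * (?M + b * ?M)"
    using assms by (rule mult_le_mono1)
  finally have outer: "length (outer_code b N Fs) \<le> ?L * (?M + b * ?M)" for N .
  have "length (weights_code z ?L) = 3 + ?L * 2" for z
    unfolding weights_code_def length_append by (subst length_loop[where l = 2]) simp_all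
  moreover have "3 + ?L * 2 \<le> ?L * ?M * 5"
  proof -
    have "1 \<le> ?L * ?M" "?L \<le> ?L * ?M" by simp_all
    then show ?thesis by linarith
  qed
  ultimately have weights: "length (weights_code z ?L) \<le> ?L * ?M * 5" for z by simp
  have blocks: "length (blocks_code a ?M R N ?M) \<le> ?M * ((7 * a + 3) * ?L)" for N
    unfolding blocks_code_def by (rule length_loop_le) (rule length_sc_code)
  have "length (encoder_code a b R Fs) \<le>
      ?L * (?M + b * ?M) + (?L * ?M * 5 + ?M * ((7 * a + 3) * ?L))"
    unfolding encoder_code_def Let_def length_append by (intro add_mono outer weights blocks)
  also have "\<dots> \<le> ?L * ?M * (9 + 7 * (a + b))" by (simp add: algebra_simps)
  finally show ?thesis .
qed

theorem proposition1:
  shows "\<exists>(prog :: nat \<Rightarrow> nat \<Rightarrow> nat set \<Rightarrow> nat set list \<Rightarrow> instr list) (T :: nat \<Rightarrow> real).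
    T \<in> O(\<lambda>N. real N * log 2 (real N)) \<and>
    (\<forall>(W :: bit \<Rightarrow> 'y::finite pmf) (p :: real) (\<epsilon> :: real) (a :: nat) (b :: nat)
        (Fs :: nat set list) (fs :: bit list list) (ds :: bit list list).
      capacity_achieving W p \<longrightarrow>
      valid_input (card (R_set p a \<epsilon>)) (2 ^ b) Fs fs ds \<longrightarrow>
      real (length (prog a b (R_set p a \<epsilon>) Fs)) \<le> T (2 ^ a * 2 ^ b) \<and>
      program_output (prog a b (R_set p a \<epsilon>) Fs) (2 ^ a * 2 ^ b) p (concat fs @ concat ds) =
        encoder p \<epsilon> a b Fs fs ds)"
proof (intro exI conjI allI impI)
  let ?T = "\<lambda>N. real N * (9 + 7 * log 2 (real N))"
  \<comment> \<open>For N \<ge> 2 the logarithm is at least 1 and absorbs the constant, whence 16 =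
    9 + 7; at N = 1 it vanishes.\<close>
  have "norm (?T N) \<le> 16 * norm (real N * log 2 (real N))" if "2 \<le> N" for N
  proof -
    have "1 \<le> log 2 (real N)" using that by simp
    then have "9 + 7 * log 2 (real N) \<le> 16 * log 2 (real N)" by simp
    from mult_left_mono[OF this, of "real N"] show ?thesis
      using \<open>1 \<le> log 2 (real N)\<close> by (simp add: abs_mult)
  qed
  then show "?T \<in> O(\<lambda>N. real N * log 2 (real N))"
    by (intro bigoI[of _ 16] eventually_sequentiallyI[of 2])
  fix W :: "bit \<Rightarrow> 'y pmf" and p \<epsilon> :: real and a b :: nat and Fs fs ds
  assume cap: "capacity_achieving W p" and valid: "valid_input (card (R_set p a \<epsilon>)) (2 ^ b) Fs fs ds"
  have "R_set p a \<epsilon> \<subseteq> {..<2 ^ a}" by (auto simp: R_set_def)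
  then have "length Fs \<le> 2 ^ a"
    using valid card_mono[of "{..<2 ^ a}" "R_set p a \<epsilon>"] by (simp add: valid_input_def)
  from length_encoder_code[OF this, of b "R_set p a \<epsilon>"]
  have "real (length (encoder_code a b (R_set p a \<epsilon>) Fs)) \<le> real (2 ^ a * 2 ^ b * (9 + 7 * (a + b)))"
    by (simp only: of_nat_le_iff)
  also have "\<dots> = ?T (2 ^ a * 2 ^ b)"
    by (simp add: log_mult log_nat_power)
  finally show "real (length (encoder_code a b (R_set p a \<epsilon>) Fs)) \<le> ?T (2 ^ a * 2 ^ b)" .
  show "program_output (encoder_code a b (R_set p a \<epsilon>) Fs) (2 ^ a * 2 ^ b) p (concat fs @ concat ds) =
      encoder p \<epsilon> a b Fs fs ds"
    using cap valid by (intro program_output_encoder_code) (simp_all add: capacity_achieving_def)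
qed

end
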